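(* Let $\mathbb K$ be a field and $V$ a vector space over $\mathbb K$ with $\dim V\le 6$. Let $h$ be a non-trivial linear functional on $\bigwedge^3V$ having one of the types $T_1,T_2,T_3,T_4,T^{(1)}_{10,\lambda},T^{(2)}_{10,\lambda}$ listed in the context, let $\chi$ be the associated alternating trilinear form and $H$ the hyperplane of $\mathcal G_3(V)$ defined by $h$. Then one of the following occurs. 1. $h$ has type $T_1$ (rank $3$). In this case $H$ is the trivial hyperplane centered at $\mathrm{Rad}(\chi)$ and $R^{\uparrow}(H)$ is the set of the lines of $\mathrm{PG}(V)$ that meet $[\mathrm{Rad}(\chi)]$ non-trivially. 2. $h$ has type $T_2$ (rank $5$), namely $\mathrm{Rad}(\chi)$ is $1$-dimensional. In this case $H$ is a trivial extension $\mathrm{Ext}_{\mathrm{Rad}(\chi)}(\mathrm{Exp}(H_0))$ of a symplectic hyperplane $\mathrm{Exp}(H_0)$, constructed in a complement $V_0$ of $\mathrm{Rad}(\chi)$ in $V$ starting from the line-set $H_0$ of a symplectic generalized quadrangle. The elements of $R^{\uparrow}(H)$ are the lines of $\mathrm{PG}(V)$ that either belong to $H_0$, or pass through the point $[\mathrm{Rad}(\chi)]=R_{\downarrow}(H)$, or are such that their projection onto $V_0$ is in $H_0$. 3. $h$ has type $T_3$ (rank $6$). Then $H$ is a decomposable hyperplane $\mathrm{Dec}(H_0,H_1)$ arising from the hyperplanes $H_0$ and $H_1$ of $\mathcal G_3(V_0)$ and $\mathcal G_3(V_1)$ for a suitable decomposition $V=V_0\oplus V_1$ with $\dim V_0=\dim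 V_1=3$. Then $R^{\uparrow}(H)=\{[x,y] : x\in V_0\setminus\{0\},\ y\in V_1\setminus\{0\}\}$. 4. $h$ has type $T_4$ (rank $6$). Then $R^{\uparrow}(H)=\{[x,y]=[a+b,\omega(a)] : a\in V_0\setminus\{0\},\ b\in V_1\}\cup\{[x,y] : [x,y]\subseteq V_1\}$ for a decomposition $V=V_0\oplus V_1$ with $\dim V_0=\dim V_1=3$ and $\omega$ an isomorphism of $V$ interchanging $V_0$ and $V_1$. 5. $h$ has type $T^{(1)}_{10,\lambda}$ or $T^{(2)}_{10,\lambda}$ (rank $6$). Then $R^{\uparrow}(H)$ is a Desarguesian line spread of $\mathrm{PG}(V)$ corresponding to the field extension $\mathbb K[\mu]$ with $\mu$ a root of $p_\lambda(t)$.
   Context: $\mathcal G_k(V)$ is the $k$-Grassmannian: its points are the $k$-dimensional subspaces of $V$, and its lines are the sets $\{X : Y\subset X\subset Z,\dim X=k\}$ with $\dim Y=k-1$, $\dim Z=k+1$, $Y\subset Z$. A non-zero linear functional $h$ on $\bigwedge^kV$, or equivalently the non-zero alternating $k$-linear form $\chi(v_1,\dots,v_k)=h(v_1\wedge\cdots\wedge v_k)$, defines the hyperplane $H=\{\langle v_1,\dots,v_k\rangle : \dim =k,\ \chi(v_1,\dots,v_k)=0\}$ of $\mathcal G_k(V)$ (if $\dim V=k$ then $H=\emptyset$; this is allowed). For vectors or subspaces, $[\cdot]$ denotes the corresponding projective point or subspace of $\mathrm{PG}(V)$; $[x,y]$ is the line spanned by independent vectors $x,y$. For $k=3$: the upper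 radical $R^{\uparrow}(H)$ is the set of lines of $\mathrm{PG}(V)$ (2-dimensional subspaces $\langle x,y\rangle$) with $h(x\wedge y\wedge z)=0$ for all $z\in V$. The lower radical is $R_{\downarrow}(H)=[\mathrm{Rad}(\chi)]$, where $\mathrm{Rad}(\chi)=\{v\in V:\chi(x,y,v)=0\ \forall x,y\in V\}$. The rank of $h$ is $\dim(V/\mathrm{Rad}(\chi))$. Types. Two functionals $h,h'$ on $\bigwedge^3V$ are nearly equivalent if, for some $g\in \mathrm{GL}(V)$ and non-zero scalar $c$, $h'(x\wedge y\wedge z)=c\,h(gx\wedge gy\wedge gz)$ for all $x,y,z$. Let $(e_i)$ be a basis of $V$, $(e^i)$ the dual basis, $\underline{ijk}=e^i\wedge e^j\wedge e^k$. A functional has a given type if it is nearly equivalent to the following one (with $\dim V$ at least the rank): $T_1$: $\underline{123}$; $T_2$: $\underline{123}+\underline{145}$; $T_3$: $\underline{123}+\underline{456}$; $T_4$: $\underline{162}+\underline{243}+\underline{135}$; $T^{(1)}_{10,\lambda}$: $\underline{123}+\lambda(\underline{156}+\underline{345}+\underline{426})$, where $p_\lambda(t)=t^2-\lambda$ is irreducible in $\mathbb K[t]$; $T^{(2)}_{10,\lambda}$: $\underline{126}+\underline{153}+\underline{234}+(\lambda^2+1)\underline{456}+\lambda(\underline{156}+\underline{345}+\underline{426})$, where $\mathrm{char}\,\mathbb K=2$ and $p_\lambda(t)=t^2+\lambda t+1$ is irreducible in $\mathbb K[t]$. Constructions. (Extension) If $V=V_0\oplus V_1$ and $H_0$ is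 the hyperplane of $\mathcal G_3(V_0)$ defined by a form $\chi_0$, then the trivial extension $\mathrm{Ext}_{V_1}(H_0)$ is the hyperplane of $\mathcal G_3(V)$ defined by $\chi(x,y,z)=\chi_0(\pi x,\pi y,\pi z)$, $\pi$ the projection onto $V_0$ along $V_1$. If $\dim V_0=3$ (so $H_0=\emptyset$) it is called the trivial hyperplane centered at $V_1$, and it equals $\{X\in\mathcal G_3(V): X\cap V_1\neq 0\}$. (Expansion) If $W$ is a hyperplane of a vector space $U$ and $H_0$ is a hyperplane of $\mathcal G_2(W)$ (the set of lines totally isotropic for a non-zero alternating bilinear form on $W$), then $\mathrm{Exp}(H_0)=\{X\in\mathcal G_3(U): X\subset W \text{ or } X\cap W\in H_0\}$; it is called a symplectic hyperplane when the bilinear form is non-degenerate. In item 2 this is applied with $U=V_0$. A symplectic generalized quadrangle is the geometry of points and totally isotropic lines of a non-degenerate alternating form on a 4-dimensional space. (Block decomposition) If $V=V_0\oplus V_1$ and $H_i$ is the hyperplane of $\mathcal G_3(V_i)$ defined by the functional $\bar h_i$, $i=0,1$, then $\mathrm{Dec}(H_0,H_1)$ is the (block) decomposable hyperplane of $\mathcal G_3(V)$ defined by $h((x_0+x_1)\wedge(y_0+y_1)\wedge(z_0+z_1))=\bar h_0(x_0\wedge y_0\wedge z_0)+\bar h_1(x_1\wedge y_1\wedge z_1)$, with $x_i,y_i,z_i\in V_i$. A line spread of $\mathrm{PG}(V)$ is a set of lines partitioning the point set. For $\dim V=6$, the Desarguesian line spread corresponding to a quadratic field extension $\mathbb L/\mathbb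 K$ is (up to the choice of the structure) obtained by giving $V$ a structure of 3-dimensional $\mathbb L$-vector space extending its $\mathbb K$-structure and taking all 1-dimensional $\mathbb L$-subspaces, viewed as 2-dimensional $\mathbb K$-subspaces.
   Formalization: In item 2, that Rad(χ) is 1-dimensional and [Rad(χ)] = R_↓(H) is a point is claimed only for dim V = 6; if dim V = 5 a T_2 form has Rad(χ) = 0, so the clause fails and no line passes through such a point; the rest of item 2 is claimed for both dimensions. *)

theory Defs
  imports
    "HOL-Algebra.Algebraic_Closure_Type"
    "HOL-Computational_Algebra.Polynomial_Factorial"
begin

text \<open>
  A linear functional \<open>h\<close> on the third exterior power of \<open>V\<close> is represented by the alternating
  trilinear form \<open>\<chi> x y z = h (x \<and> y \<and> z)\<close>. The space \<open>V\<close> is the whole carrier type; forms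
  on a subspace \<open>U\<close> are functions on the carrier type of which only the values on \<open>U\<close> matter.
\<close>

text \<open>The polynomials \<open>t\<^sup>2 - \<lambda>\<close> and \<open>t\<^sup>2 + \<lambda> t + 1\<close>.\<close>

definition p10_1 :: "'a::field \<Rightarrow> 'a poly" where "p10_1 l = [:- l, 0, 1:]"
definition p10_2 :: "'a::field \<Rightarrow> 'a poly" where "p10_2 l = [:1, l, 1:]"

text \<open>A renamed copy of \<open>vector_space\<close>: definitions made in \<open>vector_space\<close> itself would be
  shadowed by their instances under the library's global interpretation for real vector spaces.\<close>

locale vspace = vector_space
begin

definition alternating2_on :: "'b set \<Rightarrow> ('b \<Rightarrow> 'b \<Rightarrow> 'a) \<Rightarrow> bool" where
  "alternating2_on U \<beta> \<longleftrightarrow>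
     (\<forall>x\<in>U. \<forall>x'\<in>U. \<forall>y\<in>U. \<forall>c. \<beta> (scale c x + x') y = c * \<beta> x y + \<beta> x' y) \<and>
     (\<forall>x\<in>U. \<forall>y\<in>U. \<forall>y'\<in>U. \<forall>c. \<beta> x (scale c y + y') = c * \<beta> x y + \<beta> x y') \<and>
     (\<forall>x\<in>U. \<beta> x x = 0)"

definition nondegenerate2_on :: "'b set \<Rightarrow> ('b \<Rightarrow> 'b \<Rightarrow> 'a) \<Rightarrow> bool" where
  "nondegenerate2_on U \<beta> \<longleftrightarrow> (\<forall>x\<in>U. (\<forall>y\<in>U. \<beta> x y = 0) \<longrightarrow> x = 0)"

definition alternating3_on :: "'b set \<Rightarrow> ('b \<Rightarrow> 'b \<Rightarrow> 'b \<Rightarrow> 'a) \<Rightarrow> bool" where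
  "alternating3_on U \<chi> \<longleftrightarrow>
     (\<forall>x\<in>U. \<forall>x'\<in>U. \<forall>y\<in>U. \<forall>z\<in>U. \<forall>c. \<chi> (scale c x + x') y z = c * \<chi> x y z + \<chi> x' y z) \<and>
     (\<forall>x\<in>U. \<forall>y\<in>U. \<forall>y'\<in>U. \<forall>z\<in>U. \<forall>c. \<chi> x (scale c y + y') z = c * \<chi> x y z + \<chi> x y' z) \<and>
     (\<forall>x\<in>U. \<forall>y\<in>U. \<forall>z\<in>U. \<forall>z'\<in>U. \<forall>c. \<chi> x y (scale c z + z') = c * \<chi> x y z + \<chi> x y z') \<and>
     (\<forall>x\<in>U. \<forall>y\<in>U. \<chi> x x y = 0 \<and> \<chi> x y x = 0 \<and> \<chi> y x x = 0)"

definition nonzero3_on :: "'b set \<Rightarrow> ('b \<Rightarrow> 'b \<Rightarrow> 'b \<Rightarrow> 'a) \<Rightarrow> bool" where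
  "nonzero3_on U \<chi> \<longleftrightarrow> (\<exists>x\<in>U. \<exists>y\<in>U. \<exists>z\<in>U. \<chi> x y z \<noteq> 0)"

definition grassmannian :: "nat \<Rightarrow> 'b set \<Rightarrow> 'b set set" where
  "grassmannian k U = {S. subspace S \<and> S \<subseteq> U \<and> dim S = k}"

definition hyperplane2 :: "'b set \<Rightarrow> ('b \<Rightarrow> 'b \<Rightarrow> 'a) \<Rightarrow> 'b set set" where
  "hyperplane2 U \<beta> = {span {x, y} |x y. x \<in> U \<and> y \<in> U \<and> dim (span {x, y}) = 2 \<and> \<beta> x y = 0}"

definition hyperplane3 :: "'b set \<Rightarrow> ('b \<Rightarrow> 'b \<Rightarrow> 'b \<Rightarrow> 'a) \<Rightarrow> 'b set set" where
  "hyperplane3 U \<chi> =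
     {span {x, y, z} |x y z.
        x \<in> U \<and> y \<in> U \<and> z \<in> U \<and> dim (span {x, y, z}) = 3 \<and> \<chi> x y z = 0}"

text \<open>Points and lines of \<open>PG(V)\<close> are the one- and two-dimensional subspaces of \<open>V\<close>.\<close>

definition points :: "'b set set" where "points = grassmannian 1 UNIV"
definition lines :: "'b set set" where "lines = grassmannian 2 UNIV"

definition upper_radical :: "('b \<Rightarrow> 'b \<Rightarrow> 'b \<Rightarrow> 'a) \<Rightarrow> 'b set set" where
  "upper_radical \<chi> = {span {x, y} |x y. dim (span {x, y}) = 2 \<and> (\<forall>z. \<chi> x y z = 0)}"

definition Rad :: "('b \<Rightarrow> 'b \<Rightarrow> 'b \<Rightarrow> 'a) \<Rightarrow> 'b set" where
  "Rad \<chi> = {v. \<forall>x y. \<chi> x y v = 0}"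

text \<open>The projective subspace \<open>[Rad \<chi>]\<close>, as a set of points of \<open>PG(V)\<close>.\<close>

definition lower_radical :: "('b \<Rightarrow> 'b \<Rightarrow> 'b \<Rightarrow> 'a) \<Rightarrow> 'b set set" where
  "lower_radical \<chi> = {P \<in> points. P \<subseteq> Rad \<chi>}"

text \<open>The dimension of \<open>V / Rad \<chi>\<close>; meaningful for finite-dimensional \<open>V\<close>.\<close>

definition form_rank :: "('b \<Rightarrow> 'b \<Rightarrow> 'b \<Rightarrow> 'a) \<Rightarrow> nat" where
  "form_rank \<chi> = dim UNIV - dim (Rad \<chi>)"

definition general_linear :: "('b \<Rightarrow> 'b) \<Rightarrow> bool" where
  "general_linear g \<longleftrightarrow> Vector_Spaces.linear scale scale g \<and> bij g"

definition nearly_equivalent ::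
    "('b \<Rightarrow> 'b \<Rightarrow> 'b \<Rightarrow> 'a) \<Rightarrow> ('b \<Rightarrow> 'b \<Rightarrow> 'b \<Rightarrow> 'a) \<Rightarrow> bool" where
  "nearly_equivalent \<chi> \<chi>' \<longleftrightarrow>
     (\<exists>g c. general_linear g \<and> c \<noteq> 0 \<and> (\<forall>x y z. \<chi>' x y z = c * \<chi> (g x) (g y) (g z)))"

text \<open>A basis \<open>e 1, \<dots>, e n\<close> of \<open>V\<close>, where \<open>n\<close> is the dimension of \<open>V\<close>, and its dual basis.\<close>

definition indexed_basis :: "(nat \<Rightarrow> 'b) \<Rightarrow> bool" where
  "indexed_basis e \<longleftrightarrow>
     inj_on e {1..dim UNIV} \<and> independent (e ` {1..dim UNIV}) \<and> span (e ` {1..dim UNIV}) = UNIV"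

definition dual_basis :: "(nat \<Rightarrow> 'b) \<Rightarrow> nat \<Rightarrow> 'b \<Rightarrow> 'a" where
  "dual_basis e i v = representation (e ` {1..dim UNIV}) v (e i)"

text \<open>\<open>tri e i j k\<close> is the exterior product of the dual basis vectors with indices \<open>i\<close>, \<open>j\<close>, \<open>k\<close>,
  evaluated on triples as a determinant (without a factor \<open>1/6\<close>).\<close>

definition tri :: "(nat \<Rightarrow> 'b) \<Rightarrow> nat \<Rightarrow> nat \<Rightarrow> nat \<Rightarrow> 'b \<Rightarrow> 'b \<Rightarrow> 'b \<Rightarrow> 'a" where
  "tri e i j k x y z =
     (let f = dual_basis e i; g = dual_basis e j; h = dual_basis e k in
        f x * g y * h z + f y * g z * h x + f z * g x * h y
      - f x * g z * h y - f y * g x * h z - f z * g y * h x)"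

definition has_type ::
    "nat \<Rightarrow> ((nat \<Rightarrow> 'b) \<Rightarrow> 'b \<Rightarrow> 'b \<Rightarrow> 'b \<Rightarrow> 'a) \<Rightarrow> ('b \<Rightarrow> 'b \<Rightarrow> 'b \<Rightarrow> 'a) \<Rightarrow> bool" where
  "has_type r F \<chi> \<longleftrightarrow> r \<le> dim UNIV \<and> (\<exists>e. indexed_basis e \<and> nearly_equivalent (F e) \<chi>)"

definition type_T1 :: "('b \<Rightarrow> 'b \<Rightarrow> 'b \<Rightarrow> 'a) \<Rightarrow> bool" where
  "type_T1 = has_type 3 (\<lambda>e x y z. tri e 1 2 3 x y z)"

definition type_T2 :: "('b \<Rightarrow> 'b \<Rightarrow> 'b \<Rightarrow> 'a) \<Rightarrow> bool" where
  "type_T2 = has_type 5 (\<lambda>e x y z. tri e 1 2 3 x y z + tri e 1 4 5 x y z)"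

definition type_T3 :: "('b \<Rightarrow> 'b \<Rightarrow> 'b \<Rightarrow> 'a) \<Rightarrow> bool" where
  "type_T3 = has_type 6 (\<lambda>e x y z. tri e 1 2 3 x y z + tri e 4 5 6 x y z)"

definition type_T4 :: "('b \<Rightarrow> 'b \<Rightarrow> 'b \<Rightarrow> 'a) \<Rightarrow> bool" where
  "type_T4 = has_type 6 (\<lambda>e x y z. tri e 1 6 2 x y z + tri e 2 4 3 x y z + tri e 1 3 5 x y z)"

definition type_T10_1 :: "'a \<Rightarrow> ('b \<Rightarrow> 'b \<Rightarrow> 'b \<Rightarrow> 'a) \<Rightarrow> bool" where
  "type_T10_1 l \<chi> \<longleftrightarrow> irreducible (p10_1 l) \<and>
     has_type 6 (\<lambda>e x y z. tri e 1 2 3 x y z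
        + l * (tri e 1 5 6 x y z + tri e 3 4 5 x y z + tri e 4 2 6 x y z)) \<chi>"

definition type_T10_2 :: "'a \<Rightarrow> ('b \<Rightarrow> 'b \<Rightarrow> 'b \<Rightarrow> 'a) \<Rightarrow> bool" where
  "type_T10_2 l \<chi> \<longleftrightarrow> CHAR('a) = 2 \<and> irreducible (p10_2 l) \<and>
     has_type 6 (\<lambda>e x y z. tri e 1 2 6 x y z + tri e 1 5 3 x y z + tri e 2 3 4 x y z
        + (l\<^sup>2 + 1) * tri e 4 5 6 x y z
        + l * (tri e 1 5 6 x y z + tri e 3 4 5 x y z + tri e 4 2 6 x y z)) \<chi>"

definition direct_sum :: "'b set \<Rightarrow> 'b set \<Rightarrow> bool" where
  "direct_sum V0 V1 \<longleftrightarrow>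
     subspace V0 \<and> subspace V1 \<and> V0 \<inter> V1 = {0} \<and> {x + y |x y. x \<in> V0 \<and> y \<in> V1} = UNIV"

text \<open>\<open>proj V0 V1\<close> is the projection onto \<open>V0\<close> along \<open>V1\<close>.\<close>

definition proj :: "'b set \<Rightarrow> 'b set \<Rightarrow> 'b \<Rightarrow> 'b" where
  "proj V0 V1 v = (THE x. x \<in> V0 \<and> v - x \<in> V1)"

text \<open>\<open>H\<close> is the trivial extension of the hyperplane \<open>H0\<close> of \<open>grassmannian 3 V0\<close> along \<open>V1\<close>.
  The construction goes through a form defining \<open>H0\<close>, hence the relational style.\<close>

definition is_Ext :: "'b set \<Rightarrow> 'b set \<Rightarrow> 'b set set \<Rightarrow> 'b set set \<Rightarrow> bool" where
  "is_Ext V0 V1 H0 H \<longleftrightarrow> direct_sum V0 V1 \<and>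
     (\<exists>\<chi>0. alternating3_on V0 \<chi>0 \<and> nonzero3_on V0 \<chi>0 \<and> H0 = hyperplane3 V0 \<chi>0 \<and>
        H = hyperplane3 UNIV (\<lambda>x y z. \<chi>0 (proj V0 V1 x) (proj V0 V1 y) (proj V0 V1 z)))"

definition trivial_hyperplane_centered_at :: "'b set \<Rightarrow> 'b set set \<Rightarrow> bool" where
  "trivial_hyperplane_centered_at V1 H \<longleftrightarrow> (\<exists>V0. dim V0 = 3 \<and> is_Ext V0 V1 {} H)"

definition Exp :: "'b set \<Rightarrow> 'b set \<Rightarrow> 'b set set \<Rightarrow> 'b set set" where
  "Exp U W H0 = {S \<in> grassmannian 3 U. S \<subseteq> W \<or> S \<inter> W \<in> H0}"

text \<open>\<open>H0\<close> is the line set of a symplectic generalized quadrangle with point set \<open>PG(W)\<close>.\<close>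

definition symplectic_GQ_lines :: "'b set \<Rightarrow> 'b set set \<Rightarrow> bool" where
  "symplectic_GQ_lines W H0 \<longleftrightarrow> subspace W \<and> dim W = 4 \<and>
     (\<exists>\<beta>. alternating2_on W \<beta> \<and> nondegenerate2_on W \<beta> \<and> H0 = hyperplane2 W \<beta>)"

text \<open>\<open>H\<close> is a decomposable hyperplane arising from the hyperplanes \<open>H0\<close> and \<open>H1\<close> of
  \<open>grassmannian 3 V0\<close> and \<open>grassmannian 3 V1\<close>.\<close>

definition is_Dec ::
    "'b set \<Rightarrow> 'b set \<Rightarrow> 'b set set \<Rightarrow> 'b set set \<Rightarrow> 'b set set \<Rightarrow> bool" where
  "is_Dec V0 V1 H0 H1 H \<longleftrightarrow> direct_sum V0 V1 \<and>
     (\<exists>\<chi>0 \<chi>1. alternating3_on V0 \<chi>0 \<and> nonzero3_on V0 \<chi>0 \<and> H0 = hyperplane3 V0 \<chi>0 \<and>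
        alternating3_on V1 \<chi>1 \<and> nonzero3_on V1 \<chi>1 \<and> H1 = hyperplane3 V1 \<chi>1 \<and>
        H = hyperplane3 UNIV (\<lambda>x y z. \<chi>0 (proj V0 V1 x) (proj V0 V1 y) (proj V0 V1 z)
                                    + \<chi>1 (proj V1 V0 x) (proj V1 V0 y) (proj V1 V0 z)))"

definition line_spread :: "'b set set \<Rightarrow> bool" where
  "line_spread S \<longleftrightarrow> S \<subseteq> lines \<and> (\<forall>P\<in>points. \<exists>!L. L \<in> S \<and> P \<subseteq> L)"

end

text \<open>A quadratic extension field \<open>L\<close> of the field \<open>'a\<close>, realised as a subfield of an ambient field
  \<open>'l\<close> that contains \<open>'a\<close> by means of the embedding \<open>\<iota>\<close>.\<close>

definition quadratic_extension :: "('a::field \<Rightarrow> 'l::field) \<Rightarrow> 'l set \<Rightarrow> bool" where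
  "quadratic_extension \<iota> L \<longleftrightarrow>
     \<iota> 1 = 1 \<and> (\<forall>a b. \<iota> (a + b) = \<iota> a + \<iota> b) \<and> (\<forall>a b. \<iota> (a * b) = \<iota> a * \<iota> b) \<and>
     range \<iota> \<subseteq> L \<and>
     (\<forall>a\<in>L. \<forall>b\<in>L. a + b \<in> L \<and> a * b \<in> L) \<and> (\<forall>a\<in>L. - a \<in> L \<and> inverse a \<in> L) \<and>
     vector_space.dim (\<lambda>c a. \<iota> c * a) L = 2"

text \<open>The subring \<open>K[\<mu>]\<close> of \<open>'l\<close>, where \<open>K\<close> is the image of \<open>\<iota>\<close>.\<close>

definition adjoin :: "('a::field \<Rightarrow> 'l::field) \<Rightarrow> 'l \<Rightarrow> 'l set" where
  "adjoin \<iota> \<mu> = range (\<lambda>q. poly (map_poly \<iota> q) \<mu>)"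

context vspace
begin

text \<open>Scalar multiplication \<open>s\<close> by elements of \<open>L\<close> makes \<open>V\<close> a vector space over \<open>L\<close> which extends
  the given structure of \<open>V\<close>. As \<open>L\<close> is a subset of a type, the library locale does not apply;
  the values of \<open>s\<close> on scalars outside of \<open>L\<close> are irrelevant.\<close>

definition extends_scalars :: "('a \<Rightarrow> 'l::field) \<Rightarrow> 'l set \<Rightarrow> ('l \<Rightarrow> 'b \<Rightarrow> 'b) \<Rightarrow> bool" where
  "extends_scalars \<iota> L s \<longleftrightarrow>
     (\<forall>a\<in>L. \<forall>x y. s a (x + y) = s a x + s a y) \<and>
     (\<forall>a\<in>L. \<forall>b\<in>L. \<forall>x. s (a + b) x = s a x + s b x) \<and>
     (\<forall>a\<in>L. \<forall>b\<in>L. \<forall>x. s a (s b x) = s (a * b) x) \<and>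
     (\<forall>x. s 1 x = x) \<and>
     (\<forall>c x. s (\<iota> c) x = scale c x)"

definition three_dimensional_over :: "'l set \<Rightarrow> ('l \<Rightarrow> 'b \<Rightarrow> 'b) \<Rightarrow> bool" where
  "three_dimensional_over L s \<longleftrightarrow>
     (\<exists>b1 b2 b3. \<forall>v. \<exists>!(a1, a2, a3). a1 \<in> L \<and> a2 \<in> L \<and> a3 \<in> L \<and> v = s a1 b1 + s a2 b2 + s a3 b3)"

definition desarguesian_line_spread ::
    "('a \<Rightarrow> 'l::field) \<Rightarrow> 'l set \<Rightarrow> 'b set set \<Rightarrow> bool" where
  "desarguesian_line_spread \<iota> L S \<longleftrightarrow>
     quadratic_extension \<iota> L \<and> line_spread S \<and>
     (\<exists>s. extends_scalars \<iota> L s \<and> three_dimensional_over L s \<and>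
        S = {{s a v |a. a \<in> L} |v. v \<noteq> 0})"

end

end

theory Submission
  imports Defs
begin

text \<open>
  Near equivalence only moves the basis and rescales the form, so a form of one of the listed types
  is, up to a non-zero factor, the given sum of exterior products \<open>wedge f i j k\<close> for some basis
  \<open>e\<close> of \<open>V\<close> with dual basis \<open>f\<close> (\<open>has_type_normal_form\<close>). All claims then
  become statements about coordinates.

  A line \<open>L\<close> belongs to the upper radical iff \<open>\<chi>\<close> vanishes on \<open>L \<times> L \<times> V\<close>
  (\<open>upper_radical_iff\<close>). Taking basis vectors \<open>e k\<close> in the third place turns this into
  the vanishing of certain \<open>2 \<times> 2\<close> minors of the coordinates of pairs of vectors of \<open>L\<close>, and
  when all minors with indices in a set \<open>I\<close> vanish, the functionals \<open>f i\<close>, \<open>i \<in> I\<close>, have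
  a common non-zero zero on \<open>L\<close> (\<open>line_meets_kernels\<close>): \<open>L\<close> meets a coordinate subspace.
  For type T1 this subspace is the radical. For type T3 both coordinate subspaces \<open>V\<^sub>0\<close> and
  \<open>V\<^sub>1\<close> are met. For type T4 the line meets \<open>V\<^sub>1\<close>, and the remaining equations say that, unless
  \<open>L\<close> lies in \<open>V\<^sub>1\<close>, the coordinate swap maps the projections to \<open>V\<^sub>0\<close> of the vectors of
  \<open>L\<close> to multiples of the vectors of \<open>L\<close> in \<open>V\<^sub>1\<close>. For type T2 one has
  \<open>\<chi> x y z = c (f 1 x \<beta>(y,z) + f 1 y \<beta>(z,x) + f 1 z \<beta>(x,y))\<close> with \<open>\<beta>\<close> symplectic on
  a four-dimensional space: a line of the upper radical either meets the radical or lies in the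
  kernel of \<open>f 1\<close> and is totally isotropic for \<open>\<beta>\<close>.

  The two types T10 are treated together. Let \<open>\<mu>\<^sup>2 = p + q \<mu>\<close> and let
  \<open>\<Phi> i = f i + \<mu> f (i+3)\<close> for \<open>i = 1, 2, 3\<close>; these are coordinates of a structure of a
  three-dimensional space over \<open>K[\<mu>]\<close> on \<open>V\<close>. The determinant of \<open>\<Phi> 1, \<Phi> 2, \<Phi> 3\<close> takes values
  in \<open>K[\<mu>]\<close>; expanding it with respect to the basis \<open>1, \<mu>\<close> (\<open>wedge_\<Phi>\<close>), one finds that the
  form of the first type is its coordinate at \<open>1\<close> for \<open>p = \<lambda>\<close>, \<open>q = 0\<close>, and that the form of the
  second type is its coordinate at \<open>\<mu>\<close> for \<open>p = 1\<close>, \<open>q = \<lambda>\<close>. Since the determinant is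
  linear over \<open>K[\<mu>]\<close> in its third argument, a single coordinate vanishes for all \<open>z\<close> only if the
  determinant does, that is, iff \<open>x\<close> and \<open>y\<close> are dependent over \<open>K[\<mu>]\<close>. Hence the upper radical
  consists of the one-dimensional \<open>K[\<mu>]\<close>-subspaces.
\<close>

section \<open>Points, lines and planes of a finite-dimensional space\<close>

locale fd_vspace = vspace scale + finite_dimensional_vector_space scale Basis
  for scale :: "'a::field \<Rightarrow> 'b::ab_group_add \<Rightarrow> 'b" and Basis
begin

\<comment> \<open>Numerals index the coordinates, so \<open>1\<close> has to stay a numeral; and the dimension of a span is
  characterized below by the linear independence of its generators, which rewriting \<open>dim (span S)\<close>
  to \<open>dim S\<close> would hide.\<close>
declare One_nat_def [simp del] dim_UNIV [simp del] dim_span [simp del]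

lemma dim_span2_iff:
  "dim (span {x, y}) = 2 \<longleftrightarrow> (\<forall>a b. scale a x + scale b y = 0 \<longrightarrow> a = 0 \<and> b = 0)"
proof
  assume d: "dim (span {x, y}) = 2"
  have "card {x, y} \<le> 2" by (simp add: card_insert_if)
  moreover have "dim (span {x, y}) \<le> card {x, y}"
    by (rule dim_le_card) auto
  ultimately have c: "card {x, y} = 2" using d by simp
  hence ind: "independent {x, y}"
    using d by (intro card_le_dim_spanning[of _ "span {x,y}"]) (auto simp: span_base)
  have ne: "x \<noteq> y" using c by auto
  show "\<forall>a b. scale a x + scale b y = 0 \<longrightarrow> a = 0 \<and> b = 0"
  proof (intro allI impI)
    fix a b assume "scale a x + scale b y = 0"
    hence "(\<Sum>v\<in>{x,y}. scale ((\<lambda>v. if v = x then a else b) v) v) = 0"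
      using ne by simp
    from independentD[OF ind _ subset_refl this] ne show "a = 0 \<and> b = 0"
      by (metis finite.emptyI finite.insertI insertCI)
  qed
next
  assume h: "\<forall>a b. scale a x + scale b y = 0 \<longrightarrow> a = 0 \<and> b = 0"
  have "x \<noteq> y" using h[rule_format, of 1 "-1"] by auto
  moreover have "y \<noteq> 0" using h[rule_format, of 0 1] by auto
  moreover have "x \<notin> span {y}"
  proof
    assume "x \<in> span {y}"
    then obtain k where "x = scale k y" by (auto simp: span_singleton)
    thus False using h[rule_format, of 1 "-k"] by simp
  qed
  ultimately have "independent {x, y}" by (simp add: independent_insert)
  from dim_span_eq_card_independent[OF this] \<open>x \<noteq> y\<close> show "dim (span {x, y}) = 2" by simp
qed

lemma span2_iff: "v \<in> span {x, y} \<longleftrightarrow> (\<exists>a b. v = scale a x + scale b y)"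
proof -
  have "v \<in> span {x, y} \<longleftrightarrow> (\<exists>a b. v - scale a x = scale b y)"
    by (auto simp: span_insert[of x] span_singleton image_iff)
  thus ?thesis by (simp add: algebra_simps)
qed

lemma span3_iff: "v \<in> span {x, y, z} \<longleftrightarrow> (\<exists>a b c. v = scale a x + scale b y + scale c z)"
proof -
  have "v \<in> span {x, y, z} \<longleftrightarrow> (\<exists>a b c. v - scale a x = scale b y + scale c z)"
    by (auto simp: span_insert[of x] span2_iff)
  thus ?thesis by (simp add: algebra_simps)
qed

lemma lines_iff: "L \<in> lines \<longleftrightarrow> subspace L \<and> dim L = 2"
  by (simp add: lines_def grassmannian_def)

lemma span_in_lines: "span {x, y} \<in> lines \<longleftrightarrow> dim (span {x, y}) = 2"
  by (simp add: lines_iff)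

lemma line_eq_span:
  assumes "L \<in> lines" "x \<in> L" "y \<in> L" "dim (span {x, y}) = 2"
  shows "L = span {x, y}"
  using assms by (intro subspace_dim_equal[symmetric]) (auto simp: lines_iff span_minimal)

lemma subspace_basis_through:
  assumes S: "subspace S" and w: "w \<in> S" "w \<noteq> 0"
  obtains B where "w \<in> B" "independent B" "S = span B" "card B = dim S" "B \<subseteq> S"
proof -
  have "independent {w}" using w by simp
  from maximal_independent_subset_extend[OF _ this, of S] w
  obtain B where B: "{w} \<subseteq> B" "B \<subseteq> S" "independent B" "S \<subseteq> span B" by auto
  have "S = span B" using B S by (meson span_minimal subset_antisym)
  with B show ?thesis by (intro that[of B]) (auto simp: dim_span_eq_card_independent span_base)
qed

lemma line_through:
  assumes L: "L \<in> lines" and w: "w \<in> L" "w \<noteq> 0"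
  obtains w' where "w' \<in> L" "L = span {w, w'}" "dim (span {w, w'}) = 2"
proof -
  obtain B where B: "w \<in> B" "independent B" "L = span B" "card B = dim L" "B \<subseteq> L"
    using subspace_basis_through[of L w] L w by (auto simp: lines_iff)
  hence "card B = 2" using L by (simp add: lines_iff)
  then obtain w' where "B = {w, w'}" using B(1) by (auto simp: card_2_iff)
  thus ?thesis using B \<open>card B = 2\<close> L by (intro that[of w']) (auto simp: lines_iff)
qed

lemma line_basis:
  assumes L: "L \<in> lines"
  obtains x y where "x \<in> L" "y \<in> L" "L = span {x, y}" "dim (span {x, y}) = 2"
proof -
  have "\<exists>w\<in>L. w \<noteq> 0"
  proof (rule ccontr)
    assume "\<not> ?thesis"
    hence "L \<subseteq> {0}" by auto
    hence "dim L = 0" by simp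
    with L show False by (simp add: lines_iff del: dim_eq_0)
  qed
  with line_through[OF L] that show ?thesis by metis
qed

lemma plane_through:
  assumes S: "subspace S" "dim S = 3" and w: "w \<in> S" "w \<noteq> 0"
  obtains y z where "y \<in> S" "z \<in> S" "S = span {w, y, z}"
proof -
  obtain B where B: "w \<in> B" "independent B" "S = span B" "card B = dim S" "B \<subseteq> S"
    using subspace_basis_through[of S w] S w by auto
  hence "card B = 3" using S by simp
  then obtain x y z where "B = {x, y, z}" by (auto simp: card_3_iff)
  with B(1) obtain y z where "B = {w, y, z}" by (auto simp: insert_commute)
  thus ?thesis using B(3,5) that by auto
qed

lemma plane_basis:
  assumes S: "subspace S" "dim S = 3"
  obtains x y z where "x \<in> S" "y \<in> S" "z \<in> S" "S = span {x, y, z}"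
proof -
  have "\<exists>w\<in>S. w \<noteq> 0"
  proof (rule ccontr)
    assume "\<not> ?thesis"
    hence "S \<subseteq> {0}" by auto
    hence "dim S = 0" by simp
    with S show False by (simp del: dim_eq_0)
  qed
  with plane_through[OF S] that show ?thesis by metis
qed

section \<open>Alternating forms and the subspaces on which they vanish\<close>

lemma alternating3_rules:
  assumes "alternating3_on UNIV \<chi>"
  shows "\<chi> (x + x') y z = \<chi> x y z + \<chi> x' y z" "\<chi> (scale a x) y z = a * \<chi> x y z"
    "\<chi> x (y + y') z = \<chi> x y z + \<chi> x y' z" "\<chi> x (scale a y) z = a * \<chi> x y z"
    "\<chi> x y (z + z') = \<chi> x y z + \<chi> x y z'" "\<chi> x y (scale a z) = a * \<chi> x y z"
    "\<chi> x x y = 0" "\<chi> x y x = 0" "\<chi> y x x = 0"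
    "\<chi> y x z = - \<chi> x y z" "\<chi> x z y = - \<chi> x y z" "\<chi> 0 y z = 0" "\<chi> x 0 z = 0" "\<chi> x y 0 = 0"
proof -
  have l: "\<chi> (scale c x + x') y z = c * \<chi> x y z + \<chi> x' y z"
      "\<chi> x (scale c y + y') z = c * \<chi> x y z + \<chi> x y' z"
      "\<chi> x y (scale c z + z') = c * \<chi> x y z + \<chi> x y z'" for c x x' y y' z z'
    using assms by (simp_all add: alternating3_on_def)
  have alt: "\<chi> x x y = 0" "\<chi> x y x = 0" "\<chi> y x x = 0" for x y
    using assms by (simp_all add: alternating3_on_def)
  have add: "\<chi> (x + x') y z = \<chi> x y z + \<chi> x' y z" "\<chi> x (y + y') z = \<chi> x y z + \<chi> x y' z"
      "\<chi> x y (z + z') = \<chi> x y z + \<chi> x y z'" for x x' y y' z z'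
    using l(1)[of 1] l(2)[of _ 1] l(3)[of _ _ 1] by simp_all
  have z: "\<chi> 0 y z = 0" "\<chi> x 0 z = 0" "\<chi> x y 0 = 0" for x y z
    using l(1)[of "- 1" 0 0 y z] l(2)[of x "- 1" 0 0 z] l(3)[of x y "- 1" 0 0] by simp_all
  have sc: "\<chi> (scale a x) y z = a * \<chi> x y z" "\<chi> x (scale a y) z = a * \<chi> x y z"
     "\<chi> x y (scale a z) = a * \<chi> x y z" for a x y z
    using l(1)[of a x 0] l(2)[of _ a y 0] l(3)[of _ _ a z 0] z by simp_all
  have "\<chi> y x z + \<chi> x y z = 0" using alt(1)[of "x + y" z, unfolded add] by (simp add: alt add.commute)
  moreover have "\<chi> x z y + \<chi> x y z = 0" using alt(3)[of x "y + z", unfolded add] by (simp add: alt add.commute)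
  ultimately show "\<chi> y x z = - \<chi> x y z" "\<chi> x z y = - \<chi> x y z"
    by (simp_all add: eq_neg_iff_add_eq_0)
  show "\<chi> (x + x') y z = \<chi> x y z + \<chi> x' y z" "\<chi> (scale a x) y z = a * \<chi> x y z"
    "\<chi> x (y + y') z = \<chi> x y z + \<chi> x y' z" "\<chi> x (scale a y) z = a * \<chi> x y z"
    "\<chi> x y (z + z') = \<chi> x y z + \<chi> x y z'" "\<chi> x y (scale a z) = a * \<chi> x y z"
    "\<chi> x x y = 0" "\<chi> x y x = 0" "\<chi> y x x = 0" "\<chi> 0 y z = 0" "\<chi> x 0 z = 0" "\<chi> x y 0 = 0"
    by (rule add sc alt z)+
qed

text \<open>
  A line of the upper radical is given by some pair of generators \<open>x, y\<close> with \<open>\<chi> x y z = 0\<close>. By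
  bilinearity the choice of generators is immaterial, which makes membership testable on all vectors
  of the line.
\<close>

lemma upper_radical_iff:
  assumes alt: "alternating3_on UNIV \<chi>"
  shows "L \<in> upper_radical \<chi> \<longleftrightarrow> L \<in> lines \<and> (\<forall>u\<in>L. \<forall>v\<in>L. \<forall>z. \<chi> u v z = 0)"
proof
  assume "L \<in> upper_radical \<chi>"
  then obtain x y where L: "L = span {x, y}" "dim (span {x, y}) = 2" "\<And>z. \<chi> x y z = 0"
    by (auto simp: upper_radical_def)
  hence "L \<in> lines" by (simp only: span_in_lines)
  moreover have "\<chi> u v z = 0" if "u \<in> L" "v \<in> L" for u v z
    using that L(3) alternating3_rules(10)[OF alt, of x y]
    by (auto simp: L(1) span2_iff alternating3_rules(1-9)[OF alt])
  ultimately show "L \<in> lines \<and> (\<forall>u\<in>L. \<forall>v\<in>L. \<forall>z. \<chi> u v z = 0)" by blast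
next
  assume h: "L \<in> lines \<and> (\<forall>u\<in>L. \<forall>v\<in>L. \<forall>z. \<chi> u v z = 0)"
  then obtain x y where "x \<in> L" "y \<in> L" "L = span {x, y}" "dim (span {x, y}) = 2"
    using line_basis by blast
  with h show "L \<in> upper_radical \<chi>" unfolding upper_radical_def by blast
qed

text \<open>
  On the span of three vectors an alternating trilinear form is a multiple of its value at these
  vectors.
\<close>

lemma alternating3_vanish_span:
  assumes alt: "alternating3_on UNIV \<chi>" and 0: "\<chi> x y z = 0"
    and "u \<in> span {x, y, z}" "v \<in> span {x, y, z}" "w \<in> span {x, y, z}"
  shows "\<chi> u v w = 0"
proof -
  note ex = alternating3_rules[OF alt]
  have p: "\<chi> y x z = 0" "\<chi> x z y = 0" "\<chi> z x y = 0" "\<chi> y z x = 0" "\<chi> z y x = 0"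
    using 0 ex(10)[of x y z] ex(11)[of x y z] ex(10)[of x z y] ex(11)[of y x z] ex(10)[of y z x]
    by simp_all
  show ?thesis using assms(3-5) by (auto simp: span3_iff ex(1-9) p 0)
qed

lemma hyperplane3_iff:
  assumes alt: "alternating3_on UNIV \<chi>" and U: "subspace U"
  shows "S \<in> hyperplane3 U \<chi> \<longleftrightarrow>
    S \<in> grassmannian 3 U \<and> (\<forall>x\<in>S. \<forall>y\<in>S. \<forall>z\<in>S. \<chi> x y z = 0)"
proof
  assume "S \<in> hyperplane3 U \<chi>"
  then obtain x y z where S: "S = span {x, y, z}" "x \<in> U" "y \<in> U" "z \<in> U"
      "dim (span {x, y, z}) = 3" "\<chi> x y z = 0"
    by (auto simp: hyperplane3_def)
  moreover have "S \<subseteq> U" using S U span_minimal[of "{x, y, z}" U] by simp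
  ultimately show "S \<in> grassmannian 3 U \<and> (\<forall>x\<in>S. \<forall>y\<in>S. \<forall>z\<in>S. \<chi> x y z = 0)"
    using alternating3_vanish_span[OF alt S(6)] by (auto simp: grassmannian_def)
next
  assume h: "S \<in> grassmannian 3 U \<and> (\<forall>x\<in>S. \<forall>y\<in>S. \<forall>z\<in>S. \<chi> x y z = 0)"
  then obtain x y z where "x \<in> S" "y \<in> S" "z \<in> S" "S = span {x, y, z}"
    using plane_basis[of S] by (auto simp: grassmannian_def)
  with h show "S \<in> hyperplane3 U \<chi>"
    unfolding hyperplane3_def grassmannian_def by blast
qed

lemma Rad_vanish:
  assumes "alternating3_on UNIV \<chi>" "v \<in> Rad \<chi>"
  shows "\<chi> v y z = 0"
  using assms(2) alternating3_rules(10)[OF assms(1), of v y z]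
    alternating3_rules(11)[OF assms(1), of y v z]
  by (simp add: Rad_def)

text \<open>
  Choose a generator of the line in the radical: then \<open>\<chi>\<close> vanishes as soon as one argument is this
  generator.
\<close>

lemma line_meeting_Rad:
  assumes alt: "alternating3_on UNIV \<chi>" and L: "L \<in> lines" and w: "w \<in> L" "w \<in> Rad \<chi>" "w \<noteq> 0"
  shows "L \<in> upper_radical \<chi>"
proof -
  obtain w' where "L = span {w, w'}" "dim (span {w, w'}) = 2"
    using line_through[OF L w(1,3)] by metis
  thus ?thesis using Rad_vanish[OF alt w(2)] by (auto simp: upper_radical_def)
qed

lemma alternating3_on_subset:
  "alternating3_on UNIV \<chi> \<Longrightarrow> alternating3_on U \<chi>"
  by (simp add: alternating3_on_def)

lemma hyperplane2_iff:
  assumes alt: "alternating2_on UNIV \<beta>" and U: "subspace U"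
  shows "S \<in> hyperplane2 U \<beta> \<longleftrightarrow> S \<in> grassmannian 2 U \<and> (\<forall>x\<in>S. \<forall>y\<in>S. \<beta> x y = 0)"
proof
  have l: "\<beta> (scale c x + x') y = c * \<beta> x y + \<beta> x' y"
      "\<beta> x (scale c y + y') = c * \<beta> x y + \<beta> x y'" "\<beta> x x = 0" for c x x' y y'
    using alt by (simp_all add: alternating2_on_def)
  have 0: "\<beta> 0 y = 0" "\<beta> x 0 = 0" for x y
    using l(1)[of "-1" 0 0] l(2)[of _ "-1" 0 0] by simp_all
  have s: "\<beta> (scale c x) y = c * \<beta> x y" "\<beta> x (scale c y) = c * \<beta> x y" for c x y
    using l(1)[of c x 0] l(2)[of x c y 0] by (simp_all add: 0)
  have a: "\<beta> y x = - \<beta> x y" for x y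
    using l(3)[of "x + y"] l(1)[of 1 x y "x + y"] l(2)[of _ 1 x y]
    by (simp add: l(3) eq_neg_iff_add_eq_0 add.commute)
  assume "S \<in> hyperplane2 U \<beta>"
  then obtain x y where S: "S = span {x, y}" "x \<in> U" "y \<in> U" "dim (span {x, y}) = 2" "\<beta> x y = 0"
    by (auto simp: hyperplane2_def)
  moreover have "S \<subseteq> U" using S U span_minimal[of "{x, y}" U] by simp
  moreover have "\<beta> u v = 0" if "u \<in> S" "v \<in> S" for u v
    using that S(5) a[of x y] by (auto simp: S(1) span2_iff l(1,2) s l(3))
  ultimately show "S \<in> grassmannian 2 U \<and> (\<forall>x\<in>S. \<forall>y\<in>S. \<beta> x y = 0)"
    by (auto simp: grassmannian_def)
next
  assume h: "S \<in> grassmannian 2 U \<and> (\<forall>x\<in>S. \<forall>y\<in>S. \<beta> x y = 0)"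
  then obtain x y where "x \<in> S" "y \<in> S" "S = span {x, y}" "dim (span {x, y}) = 2"
    using line_basis[of S] by (auto simp: grassmannian_def lines_iff)
  with h show "S \<in> hyperplane2 U \<beta>"
    unfolding hyperplane2_def grassmannian_def by blast
qed

end

section \<open>Dual bases\<close>

definition wedge :: "(nat \<Rightarrow> 'b \<Rightarrow> 'a::field) \<Rightarrow> nat \<Rightarrow> nat \<Rightarrow> nat \<Rightarrow> 'b \<Rightarrow> 'b \<Rightarrow> 'b \<Rightarrow> 'a" where
  "wedge f i j k x y z =
     f i x * f j y * f k z + f i y * f j z * f k x + f i z * f j x * f k y
   - f i x * f j z * f k y - f i y * f j x * f k z - f i z * f j y * f k x"

text \<open>
  If \<open>u k \<noteq> 0\<close>, the coordinates of \<open>v k * u - u k * v\<close> are minors, hence zero.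
\<close>

lemma combination_zero_if_minors_zero:
  fixes u v :: "'i \<Rightarrow> 'c::field"
  assumes "\<And>i j. i \<in> I \<Longrightarrow> j \<in> I \<Longrightarrow> u i * v j = u j * v i"
  obtains a b where "a \<noteq> 0 \<or> b \<noteq> 0" "\<And>i. i \<in> I \<Longrightarrow> a * u i + b * v i = 0"
proof (cases "\<forall>i\<in>I. u i = 0")
  case True
  thus ?thesis by (intro that[of 1 0]) auto
next
  case False
  then obtain k where k: "k \<in> I" "u k \<noteq> 0" by auto
  show ?thesis
    using k assms[OF k(1)] by (intro that[of "v k" "- u k"]) (auto simp: mult.commute)
qed

text \<open>
  The functionals \<open>f i\<close> are kept as arbitrary functions with the properties of a dual basis, instead of
  being defined by \<open>dual_basis e i\<close>: after the basis is moved by an element of \<open>GL(V)\<close>, they are obtained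
  by composition, with no comparison of representations in two bases.
\<close>

locale dual_bases = fd_vspace scale Basis
  for scale :: "'a::field \<Rightarrow> 'b::ab_group_add \<Rightarrow> 'b" and Basis +
  fixes n :: nat and e :: "nat \<Rightarrow> 'b" and f :: "nat \<Rightarrow> 'b \<Rightarrow> 'a"
  assumes f_add [simp]: "f i (x + y) = f i x + f i y"
    and f_scale [simp]: "f i (scale c x) = c * f i x"
    and f_e [simp]: "i \<in> {1..n} \<Longrightarrow> j \<in> {1..n} \<Longrightarrow> f i (e j) = (if i = j then 1 else 0)"
    and expansion: "v = (\<Sum>i\<in>{1..n}. scale (f i v) (e i))"
begin

lemma f_zero [simp]: "f i 0 = 0"
  using f_scale[of i 0 0] by simp

lemma f_minus [simp]: "f i (- x) = - f i x"
  using f_add[of i x "- x"] by (simp add: eq_neg_iff_add_eq_0 add.commute)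

lemma f_diff [simp]: "f i (x - y) = f i x - f i y"
  using f_add[of i x "- y"] by simp

lemma f_sum: "f i (sum g A) = (\<Sum>a\<in>A. f i (g a))"
  by (induction A rule: infinite_finite_induct) auto

lemma vector_eq_iff: "x = y \<longleftrightarrow> (\<forall>i\<in>{1..n}. f i x = f i y)"
proof
  assume "\<forall>i\<in>{1..n}. f i x = f i y"
  hence "(\<Sum>i\<in>{1..n}. scale (f i x) (e i)) = (\<Sum>i\<in>{1..n}. scale (f i y) (e i))"
    by (intro sum.cong) auto
  thus "x = y" by (simp flip: expansion)
qed simp

lemma f_sum_e:
  assumes "I \<subseteq> {1..n}" "j \<in> {1..n}"
  shows "f j (\<Sum>i\<in>I. scale (c i) (e i)) = (if j \<in> I then c j else 0)"
proof -
  have "finite I" using assms finite_subset by auto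
  moreover have "f j (scale (c i) (e i)) = (if i = j then c i else 0)" if "i \<in> I" for i
    using assms that by (auto simp: subset_iff)
  ultimately show ?thesis by (simp add: f_sum cong: sum.cong)
qed

definition coord where "coord I = span (e ` I)"

lemma subspace_coord [simp]: "subspace (coord I)"
  by (simp add: coord_def)

lemma mem_coord:
  assumes "I \<subseteq> {1..n}"
  shows "v \<in> coord I \<longleftrightarrow> (\<forall>i\<in>{1..n} - I. f i v = 0)"
proof
  have "subspace {v. \<forall>i\<in>{1..n} - I. f i v = 0}"
    by (auto simp: subspace_def)
  moreover have "e ` I \<subseteq> {v. \<forall>i\<in>{1..n} - I. f i v = 0}"
    using assms by (auto simp: subset_iff)
  ultimately have "coord I \<subseteq> {v. \<forall>i\<in>{1..n} - I. f i v = 0}"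
    unfolding coord_def by (intro span_minimal)
  thus "v \<in> coord I \<Longrightarrow> \<forall>i\<in>{1..n} - I. f i v = 0" by auto
next
  assume "\<forall>i\<in>{1..n} - I. f i v = 0"
  hence "v = (\<Sum>i\<in>I. scale (f i v) (e i))"
    using assms by (auto simp: vector_eq_iff[of v] f_sum_e)
  moreover have "(\<Sum>i\<in>I. scale (f i v) (e i)) \<in> coord I"
    unfolding coord_def by (intro span_sum span_scale span_base) auto
  ultimately show "v \<in> coord I" by simp
qed

lemma e_independent: "independent (e ` {1..n})" and inj_e: "inj_on e {1..n}"
proof -
  show inj: "inj_on e {1..n}"
  proof
    fix i j assume "i \<in> {1..n}" "j \<in> {1..n}" "e i = e j"
    thus "i = j" using f_e[of i i] f_e[of i j] by (auto split: if_splits)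
  qed
  have "u i = 0" if "(\<Sum>i\<in>{1..n}. scale (u i) (e i)) = 0" "i \<in> {1..n}" for u i
    using that f_sum_e[of "{1..n}" i u] by simp
  from this[of "\<lambda>i. u (e i)" for u]
  have "u (e i) = 0" if "(\<Sum>v\<in>e ` {1..n}. scale (u v) v) = 0" "i \<in> {1..n}" for u i
    using that by (simp add: sum.reindex[OF inj] o_def)
  thus "independent (e ` {1..n})"
    by (subst independent_explicit) auto
qed

lemma dim_coord: "I \<subseteq> {1..n} \<Longrightarrow> dim (coord I) = card I"
  unfolding coord_def
  by (metis card_image dim_span_eq_card_independent e_independent image_mono independent_mono
      inj_e inj_on_subset)

lemma dim_UNIV_eq: "dim UNIV = n"
proof -
  have "coord {1..n} = UNIV" by (auto simp: mem_coord)
  thus ?thesis using dim_coord[of "{1..n}"] by simp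
qed

lemma proj_coord:
  assumes "I \<inter> J = {}" "I \<union> J = {1..n}"
  shows "proj (coord I) (coord J) v = (\<Sum>i\<in>I. scale (f i v) (e i))"
proof -
  have IJ: "I \<subseteq> {1..n}" "J \<subseteq> {1..n}" "{1..n} - I = J" "{1..n} - J = I" using assms by auto
  show ?thesis unfolding proj_def
  proof (rule the_equality)
    show "(\<Sum>i\<in>I. scale (f i v) (e i)) \<in> coord I \<and> v - (\<Sum>i\<in>I. scale (f i v) (e i)) \<in> coord J"
      using IJ assms(1) by (auto simp: mem_coord f_sum_e subset_iff simp del: atLeastAtMost_iff)
  next
    fix x assume "x \<in> coord I \<and> v - x \<in> coord J"
    thus "x = (\<Sum>i\<in>I. scale (f i v) (e i))"
      using IJ by (auto simp: mem_coord vector_eq_iff[of x] f_sum_e simp del: atLeastAtMost_iff)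
  qed
qed

lemma f_proj_coord:
  assumes "I \<inter> J = {}" "I \<union> J = {1..n}" "j \<in> {1..n}"
  shows "f j (proj (coord I) (coord J) v) = (if j \<in> I then f j v else 0)"
proof -
  have "I \<subseteq> {1..n}" using assms(2) by blast
  thus ?thesis using assms by (simp add: proj_coord f_sum_e)
qed

lemma direct_sum_coord:
  assumes "I \<inter> J = {}" "I \<union> J = {1..n}"
  shows "direct_sum (coord I) (coord J)"
proof -
  have IJ: "I \<subseteq> {1..n}" "J \<subseteq> {1..n}" "{1..n} - I = J" "{1..n} - J = I" using assms by auto
  have "coord I \<inter> coord J = {0}"
    using IJ by (fastforce simp: mem_coord vector_eq_iff[of _ 0] simp del: atLeastAtMost_iff)
  moreover have "\<exists>x y. v = x + y \<and> x \<in> coord I \<and> y \<in> coord J" for v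
  proof (intro exI conjI)
    let ?p = "\<lambda>I. \<Sum>i\<in>I. scale (f i v) (e i)"
    show "v = ?p I + ?p J"
      using IJ assms by (auto simp: vector_eq_iff[of v] f_sum_e simp del: atLeastAtMost_iff)
    show "?p I \<in> coord I" "?p J \<in> coord J"
      unfolding coord_def by (intro span_sum span_scale span_base imageI; assumption)+
  qed
  ultimately show ?thesis by (auto simp: direct_sum_def)
qed

text \<open>
  Vanishing minors make the restrictions of two generators of the line to the coordinates in \<open>I\<close>
  dependent; the dependency is a vector of the line, which is non-zero because the generators are
  independent.
\<close>

lemma line_meets_kernels:
  assumes L: "L \<in> lines"
    and minors: "\<And>x y i j. x \<in> L \<Longrightarrow> y \<in> L \<Longrightarrow> i \<in> I \<Longrightarrow> j \<in> I \<Longrightarrow> f i x * f j y = f j x * f i y"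
  obtains w where "w \<in> L" "w \<noteq> 0" "\<And>i. i \<in> I \<Longrightarrow> f i w = 0"
proof -
  obtain x y where xy: "x \<in> L" "y \<in> L" "L = span {x, y}" "dim (span {x, y}) = 2"
    using line_basis[OF L] by metis
  obtain a b where ab: "a \<noteq> 0 \<or> b \<noteq> 0" "\<And>i. i \<in> I \<Longrightarrow> a * f i x + b * f i y = 0"
    using combination_zero_if_minors_zero[of I "\<lambda>i. f i x" "\<lambda>i. f i y"] minors[OF xy(1,2)] by metis
  have "scale a x + scale b y \<in> L" using xy(3) by (auto simp: span2_iff)
  moreover have "scale a x + scale b y \<noteq> 0" using xy(4) ab(1) by (auto simp: dim_span2_iff)
  ultimately show ?thesis using that ab(2) by simp
qed

end

text \<open>
  If \<open>\<chi> x y z = c * F e0 (g x) (g y) (g z)\<close>, the preimages \<open>e\<close> of the basis \<open>e0\<close> under \<open>g\<close> form a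
  basis whose dual basis \<open>f\<close> is the dual basis of \<open>e0\<close> composed with \<open>g\<close>, so \<open>g\<close> is absorbed by the
  basis. The last conclusion lets the normal form \<open>F\<close>, a combination of terms \<open>tri\<close>, be
  rewritten term by term.
\<close>

lemma (in fd_vspace) has_type_normal_form:
  assumes "has_type r F \<chi>"
  obtains e f c e0 g where "r \<le> dim UNIV" "dual_bases scale Basis (dim UNIV) e f" "c \<noteq> 0"
    "\<And>x y z. \<chi> x y z = c * F e0 (g x) (g y) (g z)"
    "\<And>i j k x y z. tri e0 i j k (g x) (g y) (g z) = wedge f i j k x y z"
proof -
  let ?n = "dim UNIV"
  obtain e0 g c where r: "r \<le> ?n" and e0: "indexed_basis e0" and g: "general_linear g"
    and c: "c \<noteq> 0" and \<chi>: "\<And>x y z. \<chi> x y z = c * F e0 (g x) (g y) (g z)"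
    using assms unfolding has_type_def nearly_equivalent_def by blast
  interpret g: Vector_Spaces.linear scale scale g using g by (simp add: general_linear_def)
  have bij: "bij g" using g by (simp add: general_linear_def)
  let ?B = "e0 ` {1..?n}"
  have inj: "inj_on e0 {1..?n}" and ind: "independent ?B" and span: "span ?B = UNIV"
    using e0 by (auto simp: indexed_basis_def)
  define e where "e i = inv_into UNIV g (e0 i)" for i
  define f where "f i v = dual_basis e0 i (g v)" for i v
  have ge: "g (e i) = e0 i" for i
    using bij by (simp add: e_def bij_is_surj surj_f_inv_f)
  have "dual_bases scale Basis ?n e f"
  proof unfold_locales
    fix i j x y c
    show "f i (x + y) = f i x + f i y" "f i (scale c x) = c * f i x"
      by (simp_all add: f_def dual_basis_def g.add g.scale span
          representation_add[OF ind] representation_scale[OF ind])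
    show "f i (e j) = (if i = j then 1 else 0)" if "i \<in> {1..?n}" "j \<in> {1..?n}"
    proof -
      have "e0 j \<in> ?B" using that by blast
      thus ?thesis using that inj
        by (auto simp: f_def dual_basis_def ge representation_basis[OF ind] dest: inj_onD)
    qed
    show "x = (\<Sum>i\<in>{1..?n}. scale (f i x) (e i))"
    proof -
      have "g x = (\<Sum>b\<in>?B. scale (representation ?B (g x) b) b)"
        by (rule sum_representation_eq[symmetric, OF ind]) (auto simp: span)
      also have "\<dots> = g (\<Sum>i\<in>{1..?n}. scale (f i x) (e i))"
        by (simp add: sum.reindex[OF inj] g.sum g.scale ge f_def dual_basis_def)
      finally show ?thesis using bij by (simp add: bij_is_inj inj_eq)
    qed
  qed
  with r c \<chi> show ?thesis
    by (intro that[of e f c e0 g]) (auto simp: wedge_def tri_def Let_def f_def)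
qed

section \<open>The types of rank less than six\<close>

context dual_bases
begin

text \<open>
  The three minors of the coordinates \<open>1, 2, 3\<close> of \<open>x\<close> and \<open>y\<close> are the values of \<open>\<chi> x y\<close> at \<open>e 1\<close>, \<open>e 2\<close>,
  \<open>e 3\<close>, up to factors. They vanish on a line iff it meets the radical, the common kernel of these coordinates. The form
  on the complement \<open>\<langle>e 1, e 2, e 3\<rangle>\<close> is a determinant and has no isotropic plane.
\<close>

lemma normal_form_T1:
  assumes n: "3 \<le> n" and alt: "alternating3_on UNIV \<chi>" and c: "c \<noteq> 0"
    and \<chi>: "\<And>x y z. \<chi> x y z = c * wedge f 1 2 3 x y z"
  shows "form_rank \<chi> = 3"
    "trivial_hyperplane_centered_at (Rad \<chi>) (hyperplane3 UNIV \<chi>)"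
    "upper_radical \<chi> = {L \<in> lines. L \<inter> Rad \<chi> \<noteq> {0}}"
proof -
  let ?I = "{1, 2, 3} :: nat set" and ?J = "{4..n}"
  have IJ: "?I \<inter> ?J = {}" "?I \<union> ?J = {1..n}" "?I \<subseteq> {1..n}" "?J \<subseteq> {1..n}" "{1..n} - ?J = ?I"
    using n by auto
  have dimI: "dim (coord ?I) = 3" using dim_coord[OF IJ(3)] by simp
  have Rad: "Rad \<chi> = coord ?J"
  proof (rule Set.set_eqI)
    fix v
    have "f 1 v = 0 \<and> f 2 v = 0 \<and> f 3 v = 0" if "v \<in> Rad \<chi>"
    proof -
      have "\<chi> (e 2) (e 3) v = 0" "\<chi> (e 3) (e 1) v = 0" "\<chi> (e 1) (e 2) v = 0"
        using that by (auto simp: Rad_def)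
      thus ?thesis using n c by (simp add: \<chi> wedge_def)
    qed
    thus "v \<in> Rad \<chi> \<longleftrightarrow> v \<in> coord ?J"
      by (auto simp: mem_coord IJ Rad_def \<chi> wedge_def)
  qed
  show "form_rank \<chi> = 3" using n by (simp add: form_rank_def Rad dim_coord dim_UNIV_eq)
  have \<chi>e: "\<chi> (e 1) (e 2) (e 3) \<noteq> 0" using n c by (simp add: \<chi> wedge_def)
  have e: "e 1 \<in> coord ?I" "e 2 \<in> coord ?I" "e 3 \<in> coord ?I"
    unfolding coord_def by (auto intro: span_base)
  have "hyperplane3 (coord ?I) \<chi> = {}"
  proof (rule ccontr)
    assume "hyperplane3 (coord ?I) \<chi> \<noteq> {}"
    then obtain S where S: "S \<in> grassmannian 3 (coord ?I)" "\<forall>x\<in>S. \<forall>y\<in>S. \<forall>z\<in>S. \<chi> x y z = 0"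
      using hyperplane3_iff[OF alt, of "coord ?I"] by auto
    hence "S = coord ?I"
      by (intro subspace_dim_equal) (auto simp: grassmannian_def dimI)
    with S e \<chi>e show False by auto
  qed
  moreover have "\<chi> = (\<lambda>x y z. \<chi> (proj (coord ?I) (coord ?J) x) (proj (coord ?I) (coord ?J) y)
      (proj (coord ?I) (coord ?J) z))"
    using n by (intro ext) (simp add: \<chi> wedge_def f_proj_coord[OF IJ(1,2)])
  moreover have "nonzero3_on (coord ?I) \<chi>"
    using e \<chi>e unfolding nonzero3_on_def by blast
  ultimately have "is_Ext (coord ?I) (coord ?J) {} (hyperplane3 UNIV \<chi>)"
    unfolding is_Ext_def using direct_sum_coord[OF IJ(1,2)] alternating3_on_subset[OF alt]
    by metis
  thus "trivial_hyperplane_centered_at (Rad \<chi>) (hyperplane3 UNIV \<chi>)"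
    unfolding trivial_hyperplane_centered_at_def Rad
    by (intro exI[of _ "coord ?I"]) (simp add: dimI)
  show "upper_radical \<chi> = {L \<in> lines. L \<inter> Rad \<chi> \<noteq> {0}}"
  proof (intro Set.set_eqI iffI)
    fix L assume "L \<in> upper_radical \<chi>"
    hence L: "L \<in> lines" and 0: "\<And>u v z. u \<in> L \<Longrightarrow> v \<in> L \<Longrightarrow> \<chi> u v z = 0"
      using upper_radical_iff[OF alt] by auto
    have "f i u * f j v = f j u * f i v" if "u \<in> L" "v \<in> L" "i \<in> ?I" "j \<in> ?I" for u v i j
      using that(3,4) 0[OF that(1,2), of "e 1"] 0[OF that(1,2), of "e 2"] 0[OF that(1,2), of "e 3"] n c
      by (auto simp: \<chi> wedge_def mult.commute)
    then obtain w where w: "w \<in> L" "w \<noteq> 0" "\<And>i. i \<in> ?I \<Longrightarrow> f i w = 0"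
      using line_meets_kernels[OF L, of ?I] by metis
    hence "w \<in> Rad \<chi>" by (simp add: Rad mem_coord IJ)
    with w L show "L \<in> {L \<in> lines. L \<inter> Rad \<chi> \<noteq> {0}}" by auto
  next
    fix L assume L: "L \<in> {L \<in> lines. L \<inter> Rad \<chi> \<noteq> {0}}"
    hence "0 \<in> L \<inter> Rad \<chi>" by (auto simp: lines_iff subspace_0 Rad)
    with L obtain w where "w \<in> L" "w \<in> Rad \<chi>" "w \<noteq> 0" by blast
    thus "L \<in> upper_radical \<chi>" using line_meeting_Rad[OF alt] L by auto
  qed
qed

text \<open>
  The form \<open>\<chi>\<close> is the exterior product of \<open>f i\<close> and \<open>\<beta>\<close>. A plane of \<open>PG(U)\<close> inside the kernel
  \<open>W\<close> of \<open>f i\<close> is isotropic for trivial reasons; any other one is spanned by some \<open>u\<close> outside of \<open>W\<close> and a line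
  \<open>\<langle>a, b\<rangle>\<close> of \<open>W\<close>, and then \<open>\<chi> u a b\<close> is the multiple \<open>c * f i u\<close> of \<open>\<beta> a b\<close>.
\<close>

lemma Exp_eq_hyperplane3:
  assumes U: "subspace U" and W: "W = {w \<in> U. f i w = 0}" and c: "c \<noteq> 0"
    and alt2: "alternating2_on UNIV \<beta>" and alt: "alternating3_on UNIV \<chi>"
    and \<chi>: "\<And>x y z. \<chi> x y z = c * (f i x * \<beta> y z + f i y * \<beta> z x + f i z * \<beta> x y)"
  shows "Exp U W (hyperplane2 W \<beta>) = hyperplane3 U \<chi>"
proof (rule Set.set_eqI)
  have subW: "subspace W" using U by (auto simp: W subspace_def)
  fix S
  show "S \<in> Exp U W (hyperplane2 W \<beta>) \<longleftrightarrow> S \<in> hyperplane3 U \<chi>"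
  proof (cases "S \<in> grassmannian 3 U \<and> \<not> S \<subseteq> W")
    case False
    have "\<chi> x y z = 0" if "S \<subseteq> W" "x \<in> S" "y \<in> S" "z \<in> S" for x y z
    proof -
      have "x \<in> W" "y \<in> W" "z \<in> W" using that by auto
      thus ?thesis by (simp add: \<chi> W)
    qed
    with False show ?thesis by (auto simp: Exp_def hyperplane3_iff[OF alt U])
  next
    case True
    hence S: "subspace S" "dim S = 3" "S \<subseteq> U" by (auto simp: grassmannian_def)
    obtain u where u: "u \<in> S" "f i u \<noteq> 0" using True by (auto simp: W grassmannian_def)
    hence "u \<noteq> 0" by auto
    then obtain y z where yz: "y \<in> S" "z \<in> S" "S = span {u, y, z}"
      using plane_through[OF S(1,2) u(1)] by metis
    \<comment> \<open>Subtracting multiples of \<open>u\<close> moves the other two generators into \<open>W\<close>.\<close>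
    define a where "a = y - scale (f i y / f i u) u"
    define b where "b = z - scale (f i z / f i u) u"
    have ab0: "f i a = 0" "f i b = 0" using u by (simp_all add: a_def b_def)
    have abS: "a \<in> S" "b \<in> S"
      unfolding a_def b_def by (intro subspace_diff S subspace_scale yz u)+
    have "y \<in> span {u, a, b}" "z \<in> span {u, a, b}"
      unfolding a_def b_def
      by (subst span3_iff, rule exI[of _ "f i y / f i u"], rule exI[of _ 1], rule exI[of _ 0], simp)
        (subst span3_iff, rule exI[of _ "f i z / f i u"], rule exI[of _ 0], rule exI[of _ 1], simp)
    hence "S \<subseteq> span {u, a, b}"
      unfolding yz(3) by (intro span_minimal) (auto simp: span_base)
    moreover have "span {u, a, b} \<subseteq> S" using S(1) u abS by (intro span_minimal) auto
    ultimately have Suab: "S = span {u, a, b}" by blast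
    have SW: "S \<inter> W = span {a, b}"
    proof
      show "span {a, b} \<subseteq> S \<inter> W"
        using abS ab0 S subW by (intro span_minimal subspace_inter) (auto simp: W)
      show "S \<inter> W \<subseteq> span {a, b}"
      proof
        fix v assume v: "v \<in> S \<inter> W"
        then obtain r s t where "v = scale r u + scale s a + scale t b"
          using Suab span3_iff by blast
        moreover from this v have "r = 0" using u ab0 by (auto simp: W)
        ultimately show "v \<in> span {a, b}" by (auto simp: span2_iff)
      qed
    qed
    have "dim (insert u {a, b}) = 3" using S(2) Suab by (simp add: dim_span)
    moreover have "dim (insert u {a, b}) \<le> dim {a, b} + 1"
      by (subst dim_insert) simp
    moreover have "dim {a, b} \<le> card {a, b}" by (intro dim_le_card) (auto simp: span_base)
    moreover have "card {a, b} \<le> 2" by (simp add: card_insert_if)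
    ultimately have "dim {a, b} = 2" by linarith
    hence "dim (S \<inter> W) = 2" by (simp add: SW dim_span)
    hence gr: "S \<inter> W \<in> grassmannian 2 W"
      by (simp add: grassmannian_def S(1) subW subspace_inter)
    have "S \<in> Exp U W (hyperplane2 W \<beta>) \<longleftrightarrow> (\<forall>x\<in>S \<inter> W. \<forall>y\<in>S \<inter> W. \<beta> x y = 0)"
      using True gr by (auto simp: Exp_def hyperplane2_iff[OF alt2 subW])
    also have "\<dots> \<longleftrightarrow> (\<forall>x\<in>S. \<forall>y\<in>S. \<forall>z\<in>S. \<chi> x y z = 0)"
    proof safe
      fix x y z assume 0: "\<forall>x\<in>S \<inter> W. \<forall>y\<in>S \<inter> W. \<beta> x y = 0" and "x \<in> S" "y \<in> S" "z \<in> S"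
      have "a \<in> S \<inter> W" "b \<in> S \<inter> W" by (simp_all add: SW span_base)
      with 0 have "\<chi> u a b = 0" by (simp add: \<chi> ab0)
      thus "\<chi> x y z = 0"
        using \<open>x \<in> S\<close> \<open>y \<in> S\<close> \<open>z \<in> S\<close> alternating3_vanish_span[OF alt] Suab by metis
    next
      fix x y assume 0: "\<forall>x\<in>S. \<forall>y\<in>S. \<forall>z\<in>S. \<chi> x y z = 0" and "x \<in> S" "y \<in> S" "x \<in> W" "y \<in> W"
      with u have "\<chi> u x y = 0" by blast
      thus "\<beta> x y = 0" using \<open>x \<in> W\<close> \<open>y \<in> W\<close> c u by (simp add: \<chi> W)
    qed
    also have "\<dots> \<longleftrightarrow> S \<in> hyperplane3 U \<chi>"
      using True by (simp add: hyperplane3_iff[OF alt U])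
    finally show ?thesis .
  qed
qed

text \<open>
  The complement \<open>V0\<close> of the radical is spanned by \<open>e 1, \<dots>, e 5\<close>, and the symplectic form \<open>\<beta>\<close> is the
  contraction of the normal form by \<open>e 1\<close>, restricted to the span \<open>W\<close> of \<open>e 2, \<dots>, e 5\<close>. A line of the upper radical
  that misses the radical lies in the kernel of \<open>f 1\<close>, and its projection to \<open>V0\<close> is a totally isotropic
  line of \<open>W\<close>.
\<close>

lemma normal_form_T2:
  assumes n: "5 \<le> n" and alt: "alternating3_on UNIV \<chi>" and c: "c \<noteq> 0"
    and \<chi>: "\<And>x y z. \<chi> x y z = c * (wedge f 1 2 3 x y z + wedge f 1 4 5 x y z)"
  shows "form_rank \<chi> = 5"
    "n = 6 \<Longrightarrow> dim (Rad \<chi>) = 1 \<and> lower_radical \<chi> = {Rad \<chi>}"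
    "\<exists>V0 W H0. direct_sum V0 (Rad \<chi>) \<and> dim V0 = 5 \<and> W \<subseteq> V0 \<and> symplectic_GQ_lines W H0 \<and>
       is_Ext V0 (Rad \<chi>) (Exp V0 W H0) (hyperplane3 UNIV \<chi>) \<and>
       upper_radical \<chi> = {L \<in> lines. L \<in> H0 \<or> (\<exists>P\<in>lower_radical \<chi>. P \<subseteq> L) \<or>
         proj V0 (Rad \<chi>) ` L \<in> H0}"
proof -
  let ?I = "{1, 2, 3, 4, 5} :: nat set" and ?J = "{6..n}" and ?K = "{2, 3, 4, 5} :: nat set"
  have IJ: "?I \<inter> ?J = {}" "?I \<union> ?J = {1..n}" "?I \<subseteq> {1..n}" "?J \<subseteq> {1..n}" "{1..n} - ?J = ?I"
    "{1..n} - ?I = ?J" "?K \<subseteq> {1..n}" "{1..n} - ?K = insert 1 ?J"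
    using n by auto
  define \<beta> where "\<beta> x y = f 2 x * f 3 y - f 3 x * f 2 y + f 4 x * f 5 y - f 5 x * f 4 y" for x y
  have \<chi>\<beta>: "\<chi> x y z = c * (f 1 x * \<beta> y z + f 1 y * \<beta> z x + f 1 z * \<beta> x y)" for x y z
    by (simp add: \<chi> wedge_def \<beta>_def algebra_simps)
  have alt2: "alternating2_on UNIV \<beta>"
    by (simp add: alternating2_on_def \<beta>_def algebra_simps)
  define V0 where "V0 = coord ?I"
  define W where "W = coord ?K"
  define H0 where "H0 = hyperplane2 W \<beta>"
  define p where "p = proj V0 (Rad \<chi>)"
  have V0: "subspace V0" "dim V0 = 5"
    using dim_coord[OF IJ(3)] by (simp_all add: V0_def)
  have W: "subspace W" "dim W = 4"
    using dim_coord[OF IJ(7)] by (simp_all add: W_def)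
  have WV0: "W = {w \<in> V0. f 1 w = 0}"
    unfolding W_def V0_def mem_coord[OF IJ(3)] IJ(6)
    by (auto simp: mem_coord[OF IJ(7)] IJ(8))
  have Rad: "Rad \<chi> = coord ?J"
  proof (rule Set.set_eqI)
    fix v
    have "f 1 v = 0 \<and> f 2 v = 0 \<and> f 3 v = 0 \<and> f 4 v = 0 \<and> f 5 v = 0" if "v \<in> Rad \<chi>"
    proof -
      have "\<chi> (e 2) (e 3) v = 0" "\<chi> (e 3) (e 1) v = 0" "\<chi> (e 1) (e 2) v = 0"
        "\<chi> (e 5) (e 1) v = 0" "\<chi> (e 1) (e 4) v = 0"
        using that by (auto simp: Rad_def)
      thus ?thesis using n c by (simp add: \<chi> wedge_def)
    qed
    thus "v \<in> Rad \<chi> \<longleftrightarrow> v \<in> coord ?J"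
      by (auto simp: mem_coord IJ Rad_def \<chi> wedge_def)
  qed
  hence subRad: "subspace (Rad \<chi>)" by simp
  have mem_Rad: "v \<in> Rad \<chi> \<longleftrightarrow> (\<forall>i\<in>?I. f i v = 0)" for v
    unfolding Rad mem_coord[OF IJ(4)] IJ(5) ..
  show "form_rank \<chi> = 5" using n by (simp add: form_rank_def Rad dim_coord dim_UNIV_eq)
  show "dim (Rad \<chi>) = 1 \<and> lower_radical \<chi> = {Rad \<chi>}" if "n = 6"
  proof
    show d: "dim (Rad \<chi>) = 1" using that by (simp add: Rad dim_coord)
    show "lower_radical \<chi> = {Rad \<chi>}"
    proof (intro Set.set_eqI iffI)
      fix P assume "P \<in> lower_radical \<chi>"
      hence "P = Rad \<chi>"
        by (intro subspace_dim_equal)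
          (simp_all add: lower_radical_def points_def grassmannian_def d subRad)
      thus "P \<in> {Rad \<chi>}" by simp
    qed (simp add: lower_radical_def points_def grassmannian_def d subRad)
  qed
  have ds: "direct_sum V0 (Rad \<chi>)"
    unfolding V0_def Rad by (rule direct_sum_coord[OF IJ(1,2)])
  have fp: "f j (p v) = (if j \<in> ?I then f j v else 0)" if "j \<in> {1..n}" for j v
    unfolding p_def V0_def Rad by (rule f_proj_coord[OF IJ(1,2) that])
  have fp': "f 1 (p v) = f 1 v" "f 2 (p v) = f 2 v" "f 3 (p v) = f 3 v" "f 4 (p v) = f 4 v"
    "f 5 (p v) = f 5 v" for v
    using n by (simp_all add: fp)
  have p_lin: "p (scale a x + scale b y) = scale a (p x) + scale b (p y)" for a b x y
    by (simp add: vector_eq_iff[of "p _"] fp)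
  have \<beta>p: "\<beta> (p x) (p y) = \<beta> x y" for x y by (simp add: \<beta>_def fp')
  have nondeg: "nondegenerate2_on W \<beta>"
    unfolding nondegenerate2_on_def
  proof (intro ballI impI)
    fix x assume x: "x \<in> W" "\<forall>y\<in>W. \<beta> x y = 0"
    have "e j \<in> W" if "j \<in> ?K" for j
      using that unfolding W_def coord_def by (intro span_base imageI)
    hence "\<beta> x (e 2) = 0" "\<beta> x (e 3) = 0" "\<beta> x (e 4) = 0" "\<beta> x (e 5) = 0" using x by auto
    hence "\<forall>i\<in>?K. f i x = 0" using n by (simp add: \<beta>_def)
    moreover have "\<forall>i\<in>{1..n} - ?K. f i x = 0" using x(1) by (simp only: W_def mem_coord[OF IJ(7)])
    ultimately show "x = 0" unfolding vector_eq_iff[of x 0] f_zero by blast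
  qed
  have GQ: "symplectic_GQ_lines W H0"
    using W nondeg alt2 unfolding symplectic_GQ_lines_def H0_def
    by (auto intro!: exI[of _ \<beta>] simp: alternating2_on_def)
  have "nonzero3_on V0 \<chi>"
  proof -
    have "e 1 \<in> V0" "e 2 \<in> V0" "e 3 \<in> V0" unfolding V0_def coord_def by (auto intro: span_base)
    moreover have "\<chi> (e 1) (e 2) (e 3) \<noteq> 0" using n c by (simp add: \<chi> wedge_def)
    ultimately show ?thesis unfolding nonzero3_on_def by blast
  qed
  moreover have "Exp V0 W H0 = hyperplane3 V0 \<chi>"
    unfolding H0_def by (rule Exp_eq_hyperplane3[OF V0(1) WV0 c alt2 alt \<chi>\<beta>])
  moreover have "\<chi> = (\<lambda>x y z. \<chi> (p x) (p y) (p z))"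
    by (intro ext) (simp add: \<chi> wedge_def fp')
  ultimately have Ext: "is_Ext V0 (Rad \<chi>) (Exp V0 W H0) (hyperplane3 UNIV \<chi>)"
    unfolding is_Ext_def p_def using ds alternating3_on_subset[OF alt] by metis
  have upper: "upper_radical \<chi> =
    {L \<in> lines. L \<in> H0 \<or> (\<exists>P\<in>lower_radical \<chi>. P \<subseteq> L) \<or> p ` L \<in> H0}"
  proof (intro Set.set_eqI iffI)
    fix L assume "L \<in> upper_radical \<chi>"
    hence L: "L \<in> lines" and 0: "\<And>u v z. u \<in> L \<Longrightarrow> v \<in> L \<Longrightarrow> \<chi> u v z = 0"
      using upper_radical_iff[OF alt] by auto
    have "p ` L \<in> H0" if no: "\<not> (\<exists>P\<in>lower_radical \<chi>. P \<subseteq> L)"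
    proof -
      have LRad: "w = 0" if w: "w \<in> L" "w \<in> Rad \<chi>" for w
      proof (rule ccontr)
        assume "w \<noteq> 0"
        hence "dim (span {w}) = 1" by (simp add: dim_span)
        moreover have "span {w} \<subseteq> Rad \<chi>" "span {w} \<subseteq> L"
          using w L subRad span_minimal[of "{w}"] by (auto simp only: lines_iff empty_subsetI insert_subset)
        ultimately have "span {w} \<in> lower_radical \<chi>"
          by (simp add: lower_radical_def points_def grassmannian_def)
        with no \<open>span {w} \<subseteq> L\<close> show False by blast
      qed
      obtain x y where xy: "x \<in> L" "y \<in> L" "L = span {x, y}" "dim (span {x, y}) = 2"
        using line_basis[OF L] by metis
      have indep: "a = 0 \<and> b = 0" if "scale a x + scale b y \<in> Rad \<chi>" for a b
      proof -
        have "scale a x + scale b y \<in> L" using xy(3) by (auto simp: span2_iff)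
        thus ?thesis using LRad that xy(4) by (auto simp: dim_span2_iff)
      qed
      \<comment> \<open>The third arguments \<open>e 2, \<dots>, e 5\<close> give the minors with first index \<open>1\<close>; if \<open>f 1\<close> did not
        vanish on \<open>L\<close>, these would provide a non-zero vector of \<open>L\<close> in the radical.\<close>
      have "f 1 x * f j y = f 1 y * f j x" if "j \<in> ?I" for j
        using that 0[OF xy(1,2), of "e 2"] 0[OF xy(1,2), of "e 3"] 0[OF xy(1,2), of "e 4"]
          0[OF xy(1,2), of "e 5"] n c by (auto simp: \<chi> wedge_def mult.commute)
      hence "scale (f 1 x) y - scale (f 1 y) x \<in> Rad \<chi>" by (auto simp: mem_Rad)
      hence "scale (- f 1 y) x + scale (f 1 x) y \<in> Rad \<chi>" by simp
      from indep[OF this] have f1: "f 1 x = 0" "f 1 y = 0" by simp_all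
      have "\<beta> (p x) (p y) = 0"
        using 0[OF xy(1,2), of "e 1"] n c by (simp add: \<chi>\<beta> \<beta>p f1)
      moreover have "p x \<in> W" "p y \<in> W"
        unfolding W_def mem_coord[OF IJ(7)] using n IJ(8) by (auto simp: fp f1)
      moreover have "dim (span {p x, p y}) = 2"
        unfolding dim_span2_iff
      proof (intro allI impI)
        fix a b assume "scale a (p x) + scale b (p y) = 0"
        hence "p (scale a x + scale b y) = 0" by (simp only: p_lin)
        hence "f i (scale a x + scale b y) = 0" if "i \<in> ?I" for i
          using that IJ(3) fp[of i "scale a x + scale b y"] by auto
        hence "scale a x + scale b y \<in> Rad \<chi>" unfolding mem_Rad by blast
        thus "a = 0 \<and> b = 0" by (rule indep)
      qed
      moreover have "p ` L = span {p x, p y}"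
      proof (rule Set.set_eqI)
        fix v
        have "v \<in> p ` L \<longleftrightarrow> (\<exists>a b. v = p (scale a x + scale b y))"
          unfolding xy(3) image_iff Bex_def span2_iff by blast
        thus "v \<in> p ` L \<longleftrightarrow> v \<in> span {p x, p y}" by (simp only: p_lin span2_iff)
      qed
      ultimately show "p ` L \<in> H0" unfolding H0_def hyperplane2_def by blast
    qed
    with L show "L \<in> {L \<in> lines. L \<in> H0 \<or> (\<exists>P\<in>lower_radical \<chi>. P \<subseteq> L) \<or> p ` L \<in> H0}" by blast
  next
    fix L assume L: "L \<in> {L \<in> lines. L \<in> H0 \<or> (\<exists>P\<in>lower_radical \<chi>. P \<subseteq> L) \<or> p ` L \<in> H0}"
    hence line: "L \<in> lines" by simp
    have iso: "L \<in> upper_radical \<chi>"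
      if "\<And>u. u \<in> L \<Longrightarrow> f 1 u = 0" "\<And>u v. u \<in> L \<Longrightarrow> v \<in> L \<Longrightarrow> \<beta> u v = 0"
      using that line by (simp add: upper_radical_iff[OF alt] \<chi>\<beta>)
    from L consider "L \<in> H0" | P where "P \<in> lower_radical \<chi>" "P \<subseteq> L" | "p ` L \<in> H0" by blast
    thus "L \<in> upper_radical \<chi>"
    proof cases
      case 1
      hence "L \<subseteq> W" "\<forall>x\<in>L. \<forall>y\<in>L. \<beta> x y = 0"
        by (auto simp: H0_def hyperplane2_iff[OF alt2 W(1)] grassmannian_def)
      moreover have "f 1 u = 0" if "u \<in> W" for u using that by (simp add: WV0)
      ultimately show ?thesis by (intro iso) auto
    next
      case 2
      have "\<exists>w\<in>P. w \<noteq> 0"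
      proof (rule ccontr)
        assume "\<not> ?thesis"
        hence "dim P = 0" by auto
        thus False using 2 by (simp add: lower_radical_def points_def grassmannian_def del: dim_eq_0)
      qed
      with 2 show ?thesis
        using line_meeting_Rad[OF alt line] by (auto simp: lower_radical_def)
    next
      case 3
      hence "p ` L \<subseteq> W" "\<forall>x\<in>p ` L. \<forall>y\<in>p ` L. \<beta> x y = 0"
        by (auto simp: H0_def hyperplane2_iff[OF alt2 W(1)] grassmannian_def)
      moreover have "f 1 u = 0" if "p u \<in> W" for u using that by (simp add: WV0 fp')
      ultimately show ?thesis by (intro iso) (auto simp: \<beta>p)
    qed
  qed
  have "W \<subseteq> V0" by (auto simp: WV0)
  thus "\<exists>V0 W H0. direct_sum V0 (Rad \<chi>) \<and> dim V0 = 5 \<and> W \<subseteq> V0 \<and> symplectic_GQ_lines W H0 \<and>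
       is_Ext V0 (Rad \<chi>) (Exp V0 W H0) (hyperplane3 UNIV \<chi>) \<and>
       upper_radical \<chi> = {L \<in> lines. L \<in> H0 \<or> (\<exists>P\<in>lower_radical \<chi>. P \<subseteq> L) \<or>
         proj V0 (Rad \<chi>) ` L \<in> H0}"
    by (intro exI[of _ V0] exI[of _ W] exI[of _ H0] conjI ds V0(2) GQ Ext upper[unfolded p_def])
qed

end

section \<open>The types T3 and T4\<close>

lemma ball_up_to_six: "(\<forall>i\<in>{1..6::nat}. P i) \<longleftrightarrow> P 1 \<and> P 2 \<and> P 3 \<and> P 4 \<and> P 5 \<and> P 6"
proof -
  have "{1..6::nat} = {1, 2, 3, 4, 5, 6}" by auto
  thus ?thesis by simp
qed

text \<open>
  In rank 6 the space splits into the halves \<open>V\<^sub>0 = \<langle>e 1, e 2, e 3\<rangle>\<close> and \<open>V\<^sub>1 = \<langle>e 4, e 5, e 6\<rangle>\<close>.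
\<close>

locale dual_bases6 = dual_bases scale Basis 6 e f
  for scale :: "'a::field \<Rightarrow> 'b::ab_group_add \<Rightarrow> 'b" and Basis e f
begin

lemma zero_iff6: "v = 0 \<longleftrightarrow> f 1 v = 0 \<and> f 2 v = 0 \<and> f 3 v = 0 \<and> f 4 v = 0 \<and> f 5 v = 0 \<and> f 6 v = 0"
  unfolding vector_eq_iff[of v 0] ball_up_to_six by simp

lemma form_rank6:
  assumes "\<And>v. v \<in> Rad \<chi> \<Longrightarrow> v = 0"
  shows "form_rank \<chi> = 6"
proof -
  have "Rad \<chi> \<subseteq> {0}" using assms(1) by blast
  hence "dim (Rad \<chi>) = 0" by simp
  thus ?thesis by (simp add: form_rank_def dim_UNIV_eq del: dim_eq_0)
qed

abbreviation "V\<^sub>0 \<equiv> coord {1, 2, 3}"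
abbreviation "V\<^sub>1 \<equiv> coord {4, 5, 6}"

lemma halves: "{1, 2, 3} \<inter> {4, 5, 6 :: nat} = {}" "{1, 2, 3} \<union> {4, 5, 6} = {1..6 :: nat}"
  "{4, 5, 6} \<inter> {1, 2, 3 :: nat} = {}" "{4, 5, 6} \<union> {1, 2, 3} = {1..6 :: nat}"
  by auto

lemma mem_V0: "v \<in> V\<^sub>0 \<longleftrightarrow> f 4 v = 0 \<and> f 5 v = 0 \<and> f 6 v = 0"
  and mem_V1: "v \<in> V\<^sub>1 \<longleftrightarrow> f 1 v = 0 \<and> f 2 v = 0 \<and> f 3 v = 0"
proof -
  have "{1..6 :: nat} - {1, 2, 3} = {4, 5, 6}" "{1..6 :: nat} - {4, 5, 6} = {1, 2, 3}" by auto
  thus "v \<in> V\<^sub>0 \<longleftrightarrow> f 4 v = 0 \<and> f 5 v = 0 \<and> f 6 v = 0"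
    "v \<in> V\<^sub>1 \<longleftrightarrow> f 1 v = 0 \<and> f 2 v = 0 \<and> f 3 v = 0"
    by (simp_all add: mem_coord)
qed

lemma dim_halves: "dim V\<^sub>0 = 3" "dim V\<^sub>1 = 3"
  using dim_coord[of "{1, 2, 3}"] dim_coord[of "{4, 5, 6}"] by simp_all

lemma halves_indep:
  assumes "x \<in> V\<^sub>0" "x \<noteq> 0" "y \<in> V\<^sub>1" "y \<noteq> 0"
  shows "dim (span {x, y}) = 2"
  unfolding dim_span2_iff using assms
  by (auto simp: mem_V0 mem_V1 zero_iff6[of x] zero_iff6[of y] zero_iff6[of "_ + _"])

text \<open>
  Contraction with \<open>e 1, e 2, e 3\<close> kills the minors of the first half of the coordinates and contraction
  with \<open>e 4, e 5, e 6\<close> those of the second half; so a line of the upper radical meets both halves, and is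
  spanned by the two intersection points.
\<close>

lemma normal_form_T3:
  assumes alt: "alternating3_on UNIV \<chi>" and c: "c \<noteq> 0"
    and \<chi>: "\<And>x y z. \<chi> x y z = c * (wedge f 1 2 3 x y z + wedge f 4 5 6 x y z)"
  shows "form_rank \<chi> = 6"
    "\<exists>V0 V1 H0 H1. direct_sum V0 V1 \<and> dim V0 = 3 \<and> dim V1 = 3 \<and>
       is_Dec V0 V1 H0 H1 (hyperplane3 UNIV \<chi>) \<and>
       upper_radical \<chi> = {span {x, y} |x y. x \<in> V0 - {0} \<and> y \<in> V1 - {0}}"
proof -
  show "form_rank \<chi> = 6"
  proof (rule form_rank6)
    fix v assume "v \<in> Rad \<chi>"
    hence "\<chi> (e 2) (e 3) v = 0" "\<chi> (e 3) (e 1) v = 0" "\<chi> (e 1) (e 2) v = 0"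
      "\<chi> (e 5) (e 6) v = 0" "\<chi> (e 6) (e 4) v = 0" "\<chi> (e 4) (e 5) v = 0"
      by (auto simp: Rad_def)
    thus "v = 0" using c by (simp add: \<chi> wedge_def zero_iff6)
  qed
  have e: "e 1 \<in> V\<^sub>0" "e 2 \<in> V\<^sub>0" "e 3 \<in> V\<^sub>0" "e 4 \<in> V\<^sub>1" "e 5 \<in> V\<^sub>1" "e 6 \<in> V\<^sub>1"
    by (simp_all add: mem_V0 mem_V1)
  moreover have "\<chi> (e 1) (e 2) (e 3) \<noteq> 0" "\<chi> (e 4) (e 5) (e 6) \<noteq> 0"
    using c by (simp_all add: \<chi> wedge_def)
  ultimately have nz: "nonzero3_on V\<^sub>0 \<chi>" "nonzero3_on V\<^sub>1 \<chi>"
    unfolding nonzero3_on_def by blast+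
  have eq: "\<chi> = (\<lambda>x y z. \<chi> (proj V\<^sub>0 V\<^sub>1 x) (proj V\<^sub>0 V\<^sub>1 y) (proj V\<^sub>0 V\<^sub>1 z) +
      \<chi> (proj V\<^sub>1 V\<^sub>0 x) (proj V\<^sub>1 V\<^sub>0 y) (proj V\<^sub>1 V\<^sub>0 z))"
    by (intro ext)
      (simp add: \<chi> wedge_def f_proj_coord[OF halves(1,2)] f_proj_coord[OF halves(3,4)] distrib_left)
  have Dec: "is_Dec V\<^sub>0 V\<^sub>1 (hyperplane3 V\<^sub>0 \<chi>) (hyperplane3 V\<^sub>1 \<chi>) (hyperplane3 UNIV \<chi>)"
    unfolding is_Dec_def
    by (intro conjI exI[of _ \<chi>] refl direct_sum_coord[OF halves(1,2)]
        alternating3_on_subset[OF alt] nz arg_cong[OF eq])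
  have "upper_radical \<chi> = {span {x, y} |x y. x \<in> V\<^sub>0 - {0} \<and> y \<in> V\<^sub>1 - {0}}"
  proof (intro Set.set_eqI iffI)
    fix L assume "L \<in> upper_radical \<chi>"
    hence L: "L \<in> lines" and 0: "\<And>u v z. u \<in> L \<Longrightarrow> v \<in> L \<Longrightarrow> \<chi> u v z = 0"
      using upper_radical_iff[OF alt] by auto
    have minors: "f i u * f j v = f j u * f i v"
      if "u \<in> L" "v \<in> L" "i \<in> I" "j \<in> I" "I = {1, 2, 3} \<or> I = {4, 5, 6}" for u v i j I
      using that(3-5) 0[OF that(1,2), of "e 1"] 0[OF that(1,2), of "e 2"] 0[OF that(1,2), of "e 3"]
        0[OF that(1,2), of "e 4"] 0[OF that(1,2), of "e 5"] 0[OF that(1,2), of "e 6"] c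
      by (auto simp: \<chi> wedge_def mult.commute)
    obtain y where y: "y \<in> L" "y \<noteq> 0" "\<And>i. i \<in> {1, 2, 3} \<Longrightarrow> f i y = 0"
      using line_meets_kernels[OF L, of "{1, 2, 3}"] minors[of _ _ _ "{1, 2, 3}"] by blast
    obtain x where x: "x \<in> L" "x \<noteq> 0" "\<And>i. i \<in> {4, 5, 6} \<Longrightarrow> f i x = 0"
      using line_meets_kernels[OF L, of "{4, 5, 6}"] minors[of _ _ _ "{4, 5, 6}"] by blast
    have xy: "x \<in> V\<^sub>0" "y \<in> V\<^sub>1" using x(3) y(3) by (simp_all add: mem_V0 mem_V1)
    hence "L = span {x, y}" using x y L by (intro line_eq_span halves_indep)
    with x y xy show "L \<in> {span {x, y} |x y. x \<in> V\<^sub>0 - {0} \<and> y \<in> V\<^sub>1 - {0}}" by blast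
  next
    fix L assume "L \<in> {span {x, y} |x y. x \<in> V\<^sub>0 - {0} \<and> y \<in> V\<^sub>1 - {0}}"
    then obtain x y where xy: "L = span {x, y}" "x \<in> V\<^sub>0" "x \<noteq> 0" "y \<in> V\<^sub>1" "y \<noteq> 0" by auto
    hence "dim (span {x, y}) = 2" using halves_indep by simp
    moreover have "\<chi> x y z = 0" for z
      using xy(2,4) by (simp add: \<chi> wedge_def mem_V0 mem_V1)
    ultimately show "L \<in> upper_radical \<chi>" using xy(1) unfolding upper_radical_def by blast
  qed
  thus "\<exists>V0 V1 H0 H1. direct_sum V0 V1 \<and> dim V0 = 3 \<and> dim V1 = 3 \<and>
       is_Dec V0 V1 H0 H1 (hyperplane3 UNIV \<chi>) \<and>
       upper_radical \<chi> = {span {x, y} |x y. x \<in> V0 - {0} \<and> y \<in> V1 - {0}}"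
    using direct_sum_coord[OF halves(1,2)] dim_halves Dec by blast
qed

definition swap :: "'b \<Rightarrow> 'b" where
  "swap v = (\<Sum>i\<in>{1..6}. scale (f (if i \<le> 3 then i + 3 else i - 3) v) (e i))"

lemma f_swap: "f 1 (swap v) = f 4 v" "f 2 (swap v) = f 5 v" "f 3 (swap v) = f 6 v"
  "f 4 (swap v) = f 1 v" "f 5 (swap v) = f 2 v" "f 6 (swap v) = f 3 v"
  by (simp_all add: swap_def f_sum_e One_nat_def)

lemma eq_iff6: "x = y \<longleftrightarrow> f 1 x = f 1 y \<and> f 2 x = f 2 y \<and> f 3 x = f 3 y \<and>
    f 4 x = f 4 y \<and> f 5 x = f 5 y \<and> f 6 x = f 6 y"
  unfolding vector_eq_iff[of x y] ball_up_to_six ..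

lemma swap_swap: "swap (swap v) = v"
  by (simp add: eq_iff6 f_swap)

lemma general_linear_swap: "general_linear swap"
proof -
  have "Vector_Spaces.linear scale scale swap"
    by unfold_locales (simp_all add: eq_iff6 f_swap)
  moreover have "bij swap" by (rule involuntory_imp_bij) (rule swap_swap)
  ultimately show ?thesis by (simp add: general_linear_def)
qed

lemma swap_halves: "swap ` V\<^sub>0 = V\<^sub>1" "swap ` V\<^sub>1 = V\<^sub>0"
proof -
  have *: "v \<in> V\<^sub>0 \<longleftrightarrow> swap v \<in> V\<^sub>1" "v \<in> V\<^sub>1 \<longleftrightarrow> swap v \<in> V\<^sub>0" for v
    by (simp_all add: mem_V0 mem_V1 f_swap)
  show "swap ` V\<^sub>0 = V\<^sub>1" "swap ` V\<^sub>1 = V\<^sub>0"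
    using * swap_swap by (auto simp: image_iff) metis+
qed

text \<open>
  Write \<open>x = (a, b)\<close> and \<open>y = (a', b')\<close> with respect to the two halves, both identified with
  \<open>K\<^sup>3\<close>. Then \<open>\<chi> x y\<close> vanishes iff \<open>a \<times> a' = 0\<close> and \<open>a \<times> b' = a' \<times> b\<close>. By the first equation the
  line has a point with \<open>a' = 0\<close>; by the second one \<open>b'\<close> is then a multiple of \<open>a\<close> unless \<open>a = 0\<close>.
\<close>

lemma normal_form_T4:
  assumes alt: "alternating3_on UNIV \<chi>" and c: "c \<noteq> 0"
    and \<chi>: "\<And>x y z. \<chi> x y z = c * (wedge f 1 6 2 x y z + wedge f 2 4 3 x y z + wedge f 1 3 5 x y z)"
  shows "form_rank \<chi> = 6"
    "\<exists>V0 V1 \<omega>. direct_sum V0 V1 \<and> dim V0 = 3 \<and> dim V1 = 3 \<and>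
       general_linear \<omega> \<and> \<omega> ` V0 = V1 \<and> \<omega> ` V1 = V0 \<and>
       upper_radical \<chi> = {span {a + b, \<omega> a} |a b. a \<in> V0 - {0} \<and> b \<in> V1} \<union> {L \<in> lines. L \<subseteq> V1}"
proof -
  show "form_rank \<chi> = 6"
  proof (rule form_rank6)
    fix v assume "v \<in> Rad \<chi>"
    hence "\<chi> (e 1) (e 2) v = 0" "\<chi> (e 2) (e 3) v = 0" "\<chi> (e 3) (e 1) v = 0"
      "\<chi> (e 1) (e 6) v = 0" "\<chi> (e 1) (e 5) v = 0" "\<chi> (e 2) (e 6) v = 0"
      by (auto simp: Rad_def)
    thus "v = 0" using c by (simp add: \<chi> wedge_def zero_iff6)
  qed
  have "upper_radical \<chi> = {span {a + b, swap a} |a b. a \<in> V\<^sub>0 - {0} \<and> b \<in> V\<^sub>1} \<union> {L \<in> lines. L \<subseteq> V\<^sub>1}"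
  proof (intro Set.set_eqI iffI)
    fix L assume "L \<in> upper_radical \<chi>"
    hence L: "L \<in> lines" and 0: "\<And>u v z. u \<in> L \<Longrightarrow> v \<in> L \<Longrightarrow> \<chi> u v z = 0"
      using upper_radical_iff[OF alt] by auto
    have minors: "f i u * f j v = f j u * f i v"
      if "u \<in> L" "v \<in> L" "i \<in> {1, 2, 3}" "j \<in> {1, 2, 3}" for u v i j
      using that(3,4) 0[OF that(1,2), of "e 4"] 0[OF that(1,2), of "e 5"] 0[OF that(1,2), of "e 6"] c
      by (auto simp: \<chi> wedge_def mult.commute)
    obtain y where y: "y \<in> L" "y \<noteq> 0" "\<And>i. i \<in> {1, 2, 3} \<Longrightarrow> f i y = 0"
      using line_meets_kernels[OF L, of "{1, 2, 3}"] minors by blast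
    hence yV1: "y \<in> V\<^sub>1" by (simp add: mem_V1)
    show "L \<in> {span {a + b, swap a} |a b. a \<in> V\<^sub>0 - {0} \<and> b \<in> V\<^sub>1} \<union> {L \<in> lines. L \<subseteq> V\<^sub>1}"
    proof (cases "L \<subseteq> V\<^sub>1")
      case True
      with L show ?thesis by blast
    next
      case False
      then obtain x where x: "x \<in> L" "x \<notin> V\<^sub>1" by auto
      define a where "a = proj V\<^sub>0 V\<^sub>1 x"
      have fa: "f 1 a = f 1 x" "f 2 a = f 2 x" "f 3 a = f 3 x" "f 4 a = 0" "f 5 a = 0" "f 6 a = 0"
        by (simp_all add: a_def f_proj_coord[OF halves(1,2)])
      have a: "a \<in> V\<^sub>0" "a \<noteq> 0" using x by (auto simp: mem_V0 mem_V1 fa zero_iff6)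
      have b: "x - a \<in> V\<^sub>1" by (simp add: mem_V1 fa)
      \<comment> \<open>Since \<open>y\<close> has no component in \<open>V\<^sub>0\<close>, contraction with \<open>e 1, e 2, e 3\<close> compares the \<open>V\<^sub>0\<close>-part of \<open>x\<close>
        with \<open>y\<close>.\<close>
      have "f i (swap a) * f j y = f j (swap a) * f i y" if "i \<in> {1..6}" "j \<in> {1..6}" for i j
      proof -
        have "\<forall>i\<in>{1..6}. \<forall>j\<in>{1..6}. f i (swap a) * f j y = f j (swap a) * f i y"
          unfolding ball_up_to_six f_swap fa
          using 0[OF x(1) y(1), of "e 1"] 0[OF x(1) y(1), of "e 2"] 0[OF x(1) y(1), of "e 3"] c
            yV1[unfolded mem_V1]
          by (simp add: \<chi> wedge_def mult.commute)
        thus ?thesis using that by blast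
      qed
      then obtain r s where rs: "r \<noteq> 0 \<or> s \<noteq> 0"
          "\<And>i. i \<in> {1..6} \<Longrightarrow> r * f i (swap a) + s * f i y = 0"
        using combination_zero_if_minors_zero[of "{1..6}" "\<lambda>i. f i (swap a)" "\<lambda>i. f i y"] by metis
      hence rs0: "scale r (swap a) + scale s y = 0" by (simp add: vector_eq_iff[of _ 0])
      have "r \<noteq> 0" using rs0 rs(1) y(2) by auto
      hence "swap a = scale (- s / r) y"
        using rs0 by (simp add: eq_iff6 zero_iff6 field_simps) (simp add: add_eq_0_iff mult.commute)
      hence "swap a \<in> L" using L y(1) subspace_scale[of L y "- s / r"] by (simp add: lines_iff)
      moreover have "swap a \<in> V\<^sub>1" "swap a \<noteq> 0"
        using a swap_halves swap_swap by (auto simp: mem_V0 mem_V1 zero_iff6 f_swap)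
      hence "dim (span {x, swap a}) = 2"
        unfolding dim_span2_iff using a
        by (auto simp: zero_iff6 mem_V0 mem_V1 f_swap fa)
      ultimately have "L = span {x, swap a}" using L x(1) by (intro line_eq_span)
      hence "L = span {a + (x - a), swap a}" by simp
      with a b show ?thesis by blast
    qed
  next
    fix L assume "L \<in> {span {a + b, swap a} |a b. a \<in> V\<^sub>0 - {0} \<and> b \<in> V\<^sub>1} \<union> {L \<in> lines. L \<subseteq> V\<^sub>1}"
    then consider a b where "L = span {a + b, swap a}" "a \<in> V\<^sub>0" "a \<noteq> 0" "b \<in> V\<^sub>1" | "L \<in> lines" "L \<subseteq> V\<^sub>1"
      by blast
    thus "L \<in> upper_radical \<chi>"
    proof cases
      case 1
      have "dim (span {a + b, swap a}) = 2"
        unfolding dim_span2_iff using 1(2-4)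
        by (auto simp: zero_iff6 mem_V0 mem_V1 f_swap)
      moreover have "\<chi> (a + b) (swap a) z = 0" for z
        using 1(2,4) by (simp add: \<chi> wedge_def mem_V0 mem_V1 f_swap algebra_simps)
      ultimately show ?thesis using 1(1) unfolding upper_radical_def by blast
    next
      case 2
      hence "\<And>u. u \<in> L \<Longrightarrow> f 1 u = 0 \<and> f 2 u = 0 \<and> f 3 u = 0" using mem_V1 by blast
      with 2(1) show ?thesis by (simp add: upper_radical_iff[OF alt] \<chi> wedge_def)
    qed
  qed
  thus "\<exists>V0 V1 \<omega>. direct_sum V0 V1 \<and> dim V0 = 3 \<and> dim V1 = 3 \<and>
       general_linear \<omega> \<and> \<omega> ` V0 = V1 \<and> \<omega> ` V1 = V0 \<and>
       upper_radical \<chi> = {span {a + b, \<omega> a} |a b. a \<in> V0 - {0} \<and> b \<in> V1} \<union> {L \<in> lines. L \<subseteq> V1}"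
    using direct_sum_coord[OF halves(1,2)] dim_halves general_linear_swap swap_halves by blast
qed

end

section \<open>Quadratic extensions\<close>

text \<open>
  The minimal polynomial of \<open>\<mu>\<close> is \<open>t\<^sup>2 - q t - p\<close>, with both coefficients left free so that the two types
  T10, and inseparable extensions, are covered at once.
\<close>

locale quadratic_root =
  fixes \<iota> :: "'a::field \<Rightarrow> 'l::field" and \<mu> :: 'l and p q :: 'a
  assumes \<iota>_1 [simp]: "\<iota> 1 = 1"
    and \<iota>_add [simp]: "\<iota> (a + b) = \<iota> a + \<iota> b"
    and \<iota>_mult [simp]: "\<iota> (a * b) = \<iota> a * \<iota> b"
    and \<mu>_square: "\<mu> * \<mu> = \<iota> p + \<iota> q * \<mu>"
    and \<mu>_notin: "\<mu> \<notin> range \<iota>"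
begin

lemma \<iota>_0 [simp]: "\<iota> 0 = 0"
  using \<iota>_add[of 0 0] by (metis add_0 add_right_cancel)

lemma \<iota>_uminus [simp]: "\<iota> (- a) = - \<iota> a"
  using \<iota>_add[of a "- a"] by (simp add: eq_neg_iff_add_eq_0 add.commute)

lemma \<iota>_diff [simp]: "\<iota> (a - b) = \<iota> a - \<iota> b"
  using \<iota>_add[of a "- b"] by simp

lemma \<iota>_inverse: "a \<noteq> 0 \<Longrightarrow> \<iota> (inverse a) * \<iota> a = 1"
  by (metis \<iota>_1 \<iota>_mult left_inverse)

lemma \<iota>_eq_0_iff [simp]: "\<iota> a = 0 \<longleftrightarrow> a = 0"
  by (metis \<iota>_0 \<iota>_inverse mult_zero_right zero_neq_one)

lemma coordinates_zero: "\<iota> a + \<iota> b * \<mu> = 0 \<longleftrightarrow> a = 0 \<and> b = 0"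
proof
  assume 0: "\<iota> a + \<iota> b * \<mu> = 0"
  have "b = 0"
  proof (rule ccontr)
    assume "b \<noteq> 0"
    have "\<mu> = \<iota> (inverse b) * \<iota> b * \<mu>" using \<iota>_inverse[OF \<open>b \<noteq> 0\<close>] by simp
    also have "\<dots> = \<iota> (inverse b) * (- \<iota> a)"
      using 0 by (simp add: mult.assoc add_eq_0_iff)
    also have "\<dots> = \<iota> (- inverse b * a)" by simp
    finally show False using \<mu>_notin by blast
  qed
  with 0 show "a = 0 \<and> b = 0" by simp
qed simp

lemma coordinates_unique: "\<iota> a + \<iota> b * \<mu> = \<iota> c + \<iota> d * \<mu> \<longleftrightarrow> a = c \<and> b = d"
  using coordinates_zero[of "a - c" "b - d"] by (auto simp: algebra_simps)

lemma p_nonzero: "p \<noteq> 0"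
proof
  assume "p = 0"
  hence "\<mu> = \<iota> 0 \<or> \<mu> = \<iota> q" using \<mu>_square by auto
  thus False using \<mu>_notin by blast
qed

text \<open>
  The coordinates with respect to the basis \<open>1, \<mu>\<close> of \<open>K[\<mu>]\<close>; outside of \<open>K[\<mu>]\<close> their values are
  arbitrary.
\<close>

definition re :: "'l \<Rightarrow> 'a" where "re z = (THE a. \<exists>b. z = \<iota> a + \<iota> b * \<mu>)"
definition im :: "'l \<Rightarrow> 'a" where "im z = (THE b. \<exists>a. z = \<iota> a + \<iota> b * \<mu>)"

lemma re_coordinates [simp]: "re (\<iota> a + \<iota> b * \<mu>) = a"
  and im_coordinates [simp]: "im (\<iota> a + \<iota> b * \<mu>) = b"
  unfolding re_def im_def by (rule the_equality; auto simp: coordinates_unique)+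

abbreviation "L \<equiv> adjoin \<iota> \<mu>"

lemma \<mu>_times: "\<mu> * (\<iota> a + \<iota> b * \<mu>) = \<iota> (b * p) + \<iota> (a + b * q) * \<mu>"
proof -
  have "\<mu> * (\<iota> a + \<iota> b * \<mu>) = \<iota> a * \<mu> + \<iota> b * (\<mu> * \<mu>)" by (simp add: algebra_simps)
  thus ?thesis by (simp add: \<mu>_square algebra_simps)
qed

text \<open>
  The span of \<open>1\<close> and \<open>\<mu>\<close> is closed under \<open>z \<mapsto> c + \<mu> z\<close>, so it contains each value of a polynomial at
  \<open>\<mu>\<close>, by the scheme of Horner.
\<close>

lemma adjoin_eq: "L = {\<iota> a + \<iota> b * \<mu> |a b. True}"
proof -
  have "\<exists>a b. poly (map_poly \<iota> r) \<mu> = \<iota> a + \<iota> b * \<mu>" for r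
  proof (induction r)
    case 0
    show ?case by (intro exI[of _ 0]) simp
  next
    case (pCons c r)
    then obtain a b where r: "poly (map_poly \<iota> r) \<mu> = \<iota> a + \<iota> b * \<mu>" by auto
    have "poly (map_poly \<iota> (pCons c r)) \<mu> = \<iota> (c + b * p) + \<iota> (a + b * q) * \<mu>"
      using pCons(1) \<mu>_times[of a b] by (simp add: map_poly_pCons r)
    thus ?case by blast
  qed
  moreover have "\<iota> a + \<iota> b * \<mu> = poly (map_poly \<iota> [:a, b:]) \<mu>" for a b
    by (simp add: map_poly_pCons mult.commute)
  ultimately show ?thesis unfolding adjoin_def by blast
qed

lemma adjoin_cases:
  assumes "z \<in> L"
  obtains a b where "z = \<iota> a + \<iota> b * \<mu>"
  using assms by (auto simp: adjoin_eq)

lemma adjoin_intro: "\<iota> a + \<iota> b * \<mu> \<in> L"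
  by (auto simp: adjoin_eq)

lemma re_im: "z \<in> L \<Longrightarrow> \<iota> (re z) + \<iota> (im z) * \<mu> = z"
  by (elim adjoin_cases) simp

lemma \<iota>_in_adjoin [simp]: "\<iota> a \<in> L" and \<mu>_in_adjoin [simp]: "\<mu> \<in> L"
  using adjoin_intro[of a 0] adjoin_intro[of 0 1] by simp_all

lemma adjoin_add [simp]:
  assumes "x \<in> L" "y \<in> L"
  shows "x + y \<in> L"
proof -
  obtain a b c d where "x = \<iota> a + \<iota> b * \<mu>" "y = \<iota> c + \<iota> d * \<mu>"
    using assms by (metis adjoin_cases)
  hence "x + y = \<iota> (a + c) + \<iota> (b + d) * \<mu>" by (simp add: algebra_simps)
  thus ?thesis by (simp only: adjoin_intro)
qed

lemma adjoin_uminus [simp]: "x \<in> L \<Longrightarrow> - x \<in> L"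
  using adjoin_intro[of "- re x" "- im x"] re_im[of x]
  by (metis \<iota>_uminus minus_add_distrib mult_minus_left)

lemma adjoin_mult [simp]:
  assumes "x \<in> L" "y \<in> L"
  shows "x * y \<in> L"
proof -
  obtain a b c d where xy: "x = \<iota> a + \<iota> b * \<mu>" "y = \<iota> c + \<iota> d * \<mu>"
    using assms by (metis adjoin_cases)
  have "x * y = \<iota> (a * c) + \<iota> (a * d) * \<mu> + \<iota> b * (\<mu> * (\<iota> c + \<iota> d * \<mu>))"
    by (simp add: xy algebra_simps)
  also have "\<dots> = \<iota> (a * c + b * (d * p)) + \<iota> (a * d + b * (c + d * q)) * \<mu>"
    unfolding \<mu>_times by (simp add: algebra_simps)
  finally show ?thesis by (simp only: adjoin_intro)
qed

lemma adjoin_inverse [simp]: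
  assumes "x \<in> L"
  shows "inverse x \<in> L"
proof (cases "x = 0")
  case True
  thus ?thesis using \<iota>_in_adjoin[of 0] by simp
next
  case False
  obtain a b where x: "x = \<iota> a + \<iota> b * \<mu>" using assms by (rule adjoin_cases)
  \<comment> \<open>The conjugate and the norm of \<open>x\<close>: the other root of the minimal polynomial is \<open>q - \<mu>\<close>.\<close>
  define y where "y = \<iota> (a + b * q) + \<iota> (- b) * \<mu>"
  define N where "N = a * a + a * b * q - b * b * p"
  have "x * y = \<iota> a * y + \<iota> b * (\<mu> * y)" by (simp add: x algebra_simps)
  also have "\<dots> = \<iota> N"
    unfolding y_def \<mu>_times by (simp add: N_def algebra_simps)
  finally have xy: "x * y = \<iota> N" .
  have "y \<noteq> 0"
  proof
    assume "y = 0"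
    hence "a + b * q = 0 \<and> - b = 0" unfolding y_def by (simp only: coordinates_zero)
    hence "a = 0 \<and> b = 0" by auto
    hence "x = 0" by (simp add: x)
    with False show False by simp
  qed
  with xy False have "N \<noteq> 0" by auto
  have "x * (\<iota> (inverse N) * y) = \<iota> (inverse N) * (x * y)" by (simp only: mult_ac)
  also have "\<dots> = 1" unfolding xy by (rule \<iota>_inverse[OF \<open>N \<noteq> 0\<close>])
  finally have "x * (\<iota> (inverse N) * y) = 1" .
  hence "inverse x = \<iota> (inverse N) * y" by (rule inverse_unique)
  moreover have "y \<in> L" unfolding y_def by (rule adjoin_intro)
  ultimately show ?thesis by simp
qed

lemma quadratic_extension_adjoin: "quadratic_extension \<iota> L"
proof -
  interpret vs: vector_space "\<lambda>c a. \<iota> c * a"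
    by unfold_locales (simp_all add: algebra_simps)
  have "vs.dim L = 2"
  proof (rule vs.dim_unique[of "{1, \<mu>}"])
    show "{1, \<mu>} \<subseteq> L" using \<iota>_in_adjoin[of 1] by simp
    show "L \<subseteq> vs.span {1, \<mu>}"
    proof
      fix z assume "z \<in> L"
      then obtain a b where z: "z = \<iota> a * 1 + \<iota> b * \<mu>" by (metis adjoin_cases mult.right_neutral)
      show "z \<in> vs.span {1, \<mu>}"
        unfolding z by (intro vs.span_add vs.span_scale vs.span_base) auto
    qed
    have "\<mu> \<noteq> 1" using \<mu>_notin \<iota>_1 by (metis rangeI)
    thus "card {1, \<mu>} = 2" by simp
    have "1 \<notin> vs.span {\<mu>}"
    proof
      assume "1 \<in> vs.span {\<mu>}"
      then obtain c where "1 = \<iota> c * \<mu>" by (auto simp: vs.span_singleton)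
      thus False using coordinates_unique[of 1 0 0 c] by simp
    qed
    moreover have "\<mu> \<noteq> 0" using \<mu>_notin \<iota>_0 by (metis rangeI)
    ultimately show "vs.independent {1, \<mu>}" using \<open>\<mu> \<noteq> 1\<close> by (simp add: vs.independent_insert)
  qed
  thus ?thesis by (auto simp: quadratic_extension_def)
qed

end

text \<open>
  A root of \<open>r\<close> would split off a linear factor, with a cofactor of degree 1, which is no unit.
\<close>

lemma irreducible_quadratic_no_root:
  fixes r :: "'a::field poly"
  assumes "irreducible r" "degree r = 2"
  shows "poly r x \<noteq> 0"
proof
  assume "poly r x = 0"
  hence "[:- x, 1:] dvd r" by (simp add: poly_eq_0_iff_dvd)
  then obtain s where s: "r = [:- x, 1:] * s" by (elim dvdE)
  with assms(2) have "s \<noteq> 0" by auto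
  hence "degree r = 1 + degree s" using degree_mult_eq[of "[:- x, 1:]" s] by (simp add: s)
  moreover have "[:- x, 1:] dvd 1 \<or> s dvd 1" using assms(1) s by (rule irreducibleD)
  hence "degree s = 0" by (auto simp: is_unit_iff_degree \<open>s \<noteq> 0\<close>)
  ultimately show False using assms(2) by simp
qed

lemma quadratic_has_root_in_alg_closure:
  fixes r :: "'k::field poly"
  assumes "degree r = 2"
  shows "\<exists>\<mu>. poly (map_poly to_ac r) \<mu> = 0"
  by (rule alg_closed_imp_poly_has_root) (simp add: degree_map_poly assms)

lemma quadratic_root_to_ac:
  fixes \<mu> :: "'k::field alg_closure"
  assumes irr: "irreducible [:- p, - q, 1:]"
    and root: "poly (map_poly to_ac [:- p, - q, 1:]) \<mu> = 0"
  shows "quadratic_root to_ac \<mu> p q"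
proof unfold_locales
  have "\<mu> * \<mu> - to_ac p - to_ac q * \<mu> = 0"
    using root by (simp add: map_poly_pCons algebra_simps)
  thus eq: "\<mu> * \<mu> = to_ac p + to_ac q * \<mu>" by (simp add: algebra_simps)
  show "\<mu> \<notin> range to_ac"
  proof
    assume "\<mu> \<in> range to_ac"
    then obtain x where "\<mu> = to_ac x" by auto
    with eq have "to_ac (x * x) = to_ac (p + q * x)" by simp
    hence "poly [:- p, - q, 1:] x = 0" unfolding to_ac_eq_iff by (simp add: algebra_simps)
    thus False using irreducible_quadratic_no_root[OF irr] by simp
  qed
qed simp_all

section \<open>The types T10 and Desarguesian spreads\<close>

text \<open>
  The expansion of the determinant with rows \<open>g i + m * g (i + 3)\<close> by powers of \<open>m\<close>; the indices are
  arranged as in the normal forms of the types T10.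
\<close>

lemma wedge_add_multiple:
  "wedge (\<lambda>i v. g i v + g (i + 3) v * m) 1 2 3 x y z =
     wedge g 1 2 3 x y z
   + (wedge g 1 2 6 x y z + wedge g 1 5 3 x y z + wedge g 2 3 4 x y z) * m
   + (wedge g 1 5 6 x y z + wedge g 3 4 5 x y z + wedge g 4 2 6 x y z) * (m * m)
   + wedge g 4 5 6 x y z * (m * (m * m))"
  by (simp add: wedge_def algebra_simps)

text \<open>
  The functionals \<open>\<Phi> 1, \<Phi> 2, \<Phi> 3\<close> identify \<open>V\<close> with \<open>L\<^sup>3\<close>, where \<open>L = K[\<mu>]\<close>, and \<open>smul\<close> is the scalar
  multiplication of \<open>L\<^sup>3\<close> transported to \<open>V\<close>. The vectors \<open>e 1, e 2, e 3\<close> are an \<open>L\<close>-basis, and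
  \<open>e (i + 3) = \<mu> e i\<close>.
\<close>

locale complex_structure = dual_bases6 scale Basis e f + quadratic_root \<iota> \<mu> p q
  for scale :: "'a::field \<Rightarrow> 'b::ab_group_add \<Rightarrow> 'b" and Basis e f
    and \<iota> :: "'a \<Rightarrow> 'l::field" and \<mu> p q
begin

definition \<Phi> :: "nat \<Rightarrow> 'b \<Rightarrow> 'l" where "\<Phi> i v = \<iota> (f i v) + \<iota> (f (i + 3) v) * \<mu>"

definition smul :: "'l \<Rightarrow> 'b \<Rightarrow> 'b" where
  "smul a v = (\<Sum>i\<in>{1..6}. scale (if i \<le> 3 then re (a * \<Phi> i v) else im (a * \<Phi> (i - 3) v)) (e i))"

lemma \<Phi>_in_L [simp]: "\<Phi> i v \<in> L"
  by (simp add: \<Phi>_def adjoin_intro)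

lemma \<Phi>_add [simp]: "\<Phi> i (x + y) = \<Phi> i x + \<Phi> i y"
  by (simp add: \<Phi>_def algebra_simps)

lemma \<Phi>_scale [simp]: "\<Phi> i (scale c x) = \<iota> c * \<Phi> i x"
  by (simp add: \<Phi>_def algebra_simps)

lemma \<Phi>_0 [simp]: "\<Phi> i 0 = 0"
  by (simp add: \<Phi>_def)

lemma eq_iff_\<Phi>: "x = y \<longleftrightarrow> \<Phi> 1 x = \<Phi> 1 y \<and> \<Phi> 2 x = \<Phi> 2 y \<and> \<Phi> 3 x = \<Phi> 3 y"
  by (auto simp: \<Phi>_def coordinates_unique eq_iff6)

lemma \<Phi>_smul:
  assumes "a \<in> L" "i \<in> {1, 2, 3}"
  shows "\<Phi> i (smul a v) = a * \<Phi> i v"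
proof -
  have "f i (smul a v) = re (a * \<Phi> i v)" "f (i + 3) (smul a v) = im (a * \<Phi> i v)"
    using assms(2) by (auto simp: smul_def f_sum_e One_nat_def)
  thus ?thesis using re_im[of "a * \<Phi> i v"] assms(1) by (simp add: \<Phi>_def[of i "smul a v"])
qed

lemma \<Phi>_e: "\<Phi> 1 (e 1) = 1" "\<Phi> 2 (e 1) = 0" "\<Phi> 3 (e 1) = 0"
  "\<Phi> 1 (e 2) = 0" "\<Phi> 2 (e 2) = 1" "\<Phi> 3 (e 2) = 0"
  "\<Phi> 1 (e 3) = 0" "\<Phi> 2 (e 3) = 0" "\<Phi> 3 (e 3) = 1"
  by (simp_all add: \<Phi>_def)

lemma extends_scalars_smul: "extends_scalars \<iota> L smul"
  unfolding extends_scalars_def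
  using \<iota>_in_adjoin[of 1] by (auto simp: eq_iff_\<Phi> \<Phi>_smul algebra_simps)

lemma three_dimensional_smul: "three_dimensional_over L smul"
  unfolding three_dimensional_over_def
proof (intro exI allI)
  fix v
  have *: "v = smul a1 (e 1) + smul a2 (e 2) + smul a3 (e 3) \<longleftrightarrow> \<Phi> 1 v = a1 \<and> \<Phi> 2 v = a2 \<and> \<Phi> 3 v = a3"
    if "a1 \<in> L" "a2 \<in> L" "a3 \<in> L" for a1 a2 a3
    unfolding eq_iff_\<Phi>[of v] using that by (simp add: \<Phi>_smul \<Phi>_e)
  show "\<exists>!(a1, a2, a3). a1 \<in> L \<and> a2 \<in> L \<and> a3 \<in> L \<and> v = smul a1 (e 1) + smul a2 (e 2) + smul a3 (e 3)"
  proof (rule ex1I[of _ "(\<Phi> 1 v, \<Phi> 2 v, \<Phi> 3 v)"])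
    show "case (\<Phi> 1 v, \<Phi> 2 v, \<Phi> 3 v) of (a1, a2, a3) \<Rightarrow>
        a1 \<in> L \<and> a2 \<in> L \<and> a3 \<in> L \<and> v = smul a1 (e 1) + smul a2 (e 2) + smul a3 (e 3)"
      unfolding prod.case using *[OF \<Phi>_in_L \<Phi>_in_L \<Phi>_in_L, of 1 v 2 v 3 v]
      by (intro conjI \<Phi>_in_L) blast
  next
    fix t
    assume h: "case t of (a1, a2, a3) \<Rightarrow>
        a1 \<in> L \<and> a2 \<in> L \<and> a3 \<in> L \<and> v = smul a1 (e 1) + smul a2 (e 2) + smul a3 (e 3)"
    obtain a1 a2 a3 where t: "t = (a1, a2, a3)" by (cases t)
    show "t = (\<Phi> 1 v, \<Phi> 2 v, \<Phi> 3 v)"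
      using h *[of a1 a2 a3] unfolding t prod.case prod.inject by metis
  qed
qed

text \<open>
  Substitute \<open>\<mu>\<^sup>2 = p + q \<mu>\<close> and \<open>\<mu>\<^sup>3 = p q + (q\<^sup>2 + p) \<mu>\<close> in the expansion of the determinant by powers of
  \<open>\<mu>\<close>.
\<close>

lemma wedge_\<Phi>:
  "wedge \<Phi> 1 2 3 x y z =
     \<iota> (wedge f 1 2 3 x y z
        + p * (wedge f 1 5 6 x y z + wedge f 3 4 5 x y z + wedge f 4 2 6 x y z)
        + p * q * wedge f 4 5 6 x y z)
   + \<iota> (wedge f 1 2 6 x y z + wedge f 1 5 3 x y z + wedge f 2 3 4 x y z
        + q * (wedge f 1 5 6 x y z + wedge f 3 4 5 x y z + wedge f 4 2 6 x y z)
        + (q\<^sup>2 + p) * wedge f 4 5 6 x y z) * \<mu>"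
proof -
  have \<Phi>: "\<Phi> = (\<lambda>i v. \<iota> (f i v) + \<iota> (f (i + 3) v) * \<mu>)" by (intro ext) (rule \<Phi>_def)
  have w: "wedge (\<lambda>i v. \<iota> (f i v)) i j k x y z = \<iota> (wedge f i j k x y z)" for i j k
    by (simp add: wedge_def)
  have \<mu>2: "\<mu> * \<mu> = \<iota> p + \<iota> q * \<mu>" by (rule \<mu>_square)
  have \<mu>3: "\<mu> * (\<mu> * \<mu>) = \<iota> (p * q) + \<iota> (q\<^sup>2 + p) * \<mu>"
    unfolding \<mu>2 \<mu>_times by (simp add: power2_eq_square algebra_simps)
  show ?thesis
    unfolding \<Phi> wedge_add_multiple[of "\<lambda>i v. \<iota> (f i v)"] w \<mu>3 unfolding \<mu>2
    by (simp add: algebra_simps)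
qed

text \<open>
  The one-dimensional \<open>L\<close>-subspace spanned by \<open>v\<close>, when \<open>v \<noteq> 0\<close>.
\<close>

definition orbit :: "'b \<Rightarrow> 'b set" where "orbit v = {smul a v |a. a \<in> L}"

lemma orbit_eq_span: "orbit v = span {v, smul \<mu> v}"
proof (rule Set.set_eqI)
  fix u
  have *: "smul (\<iota> a + \<iota> b * \<mu>) v = scale a v + scale b (smul \<mu> v)" for a b
    by (simp add: eq_iff_\<Phi> \<Phi>_smul algebra_simps)
  have "u \<in> orbit v \<longleftrightarrow> (\<exists>a b. u = smul (\<iota> a + \<iota> b * \<mu>) v)"
    unfolding orbit_def adjoin_eq by blast
  thus "u \<in> orbit v \<longleftrightarrow> u \<in> span {v, smul \<mu> v}" by (simp only: * span2_iff)
qed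

lemma orbit_in_lines:
  assumes "v \<noteq> 0"
  shows "orbit v \<in> lines"
  unfolding orbit_eq_span span_in_lines dim_span2_iff
proof (intro allI impI)
  fix a b assume "scale a v + scale b (smul \<mu> v) = 0"
  hence "(\<iota> a + \<iota> b * \<mu>) * \<Phi> i v = 0" if "i \<in> {1, 2, 3}" for i
    using that by (auto simp: eq_iff_\<Phi>[of _ 0] \<Phi>_smul algebra_simps)
  moreover have "\<exists>i\<in>{1, 2, 3}. \<Phi> i v \<noteq> 0" using assms by (auto simp: eq_iff_\<Phi>[of v])
  ultimately show "a = 0 \<and> b = 0" using coordinates_zero by auto
qed

lemma orbit_self [simp]: "v \<in> orbit v"
  by (simp add: orbit_eq_span span_base)

lemma orbit_eq:
  assumes "w \<in> orbit v" "w \<noteq> 0"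
  shows "orbit w = orbit v"
proof -
  obtain a where a: "a \<in> L" "w = smul a v" using assms by (auto simp: orbit_def)
  have "v \<noteq> 0" using a assms(2) by (auto simp: eq_iff_\<Phi>[of _ 0] \<Phi>_smul)
  have "smul b w = smul (b * a) v" if "b \<in> L" for b
    using a that by (simp add: eq_iff_\<Phi> \<Phi>_smul)
  hence "orbit w \<subseteq> orbit v" using a by (auto simp: orbit_def)
  thus ?thesis
    using orbit_in_lines[OF assms(2)] orbit_in_lines[OF \<open>v \<noteq> 0\<close>]
    by (intro subspace_dim_equal) (auto simp: lines_iff)
qed

text \<open>
  Each non-zero vector generates the unique one-dimensional \<open>L\<close>-subspace that contains it.
\<close>

lemma line_spread_orbits: "line_spread {orbit v |v. v \<noteq> 0}"
  unfolding line_spread_def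
proof (intro conjI ballI)
  show "{orbit v |v. v \<noteq> 0} \<subseteq> lines" using orbit_in_lines by auto
  fix P assume "P \<in> points"
  hence P: "subspace P" "dim P = 1" by (auto simp: points_def grassmannian_def)
  have "\<exists>v\<in>P. v \<noteq> 0"
  proof (rule ccontr)
    assume "\<not> ?thesis"
    hence "dim P = 0" by auto
    with P show False by simp
  qed
  then obtain v where v: "v \<in> P" "v \<noteq> 0" by auto
  have Pv: "span {v} = P"
    using P v span_minimal[of "{v}" P] by (intro subspace_dim_equal) (simp_all add: dim_span)
  show "\<exists>!L. L \<in> {orbit v |v. v \<noteq> 0} \<and> P \<subseteq> L"
  proof (rule ex1I[of _ "orbit v"])
    have "P \<subseteq> orbit v"
      unfolding Pv[symmetric] orbit_eq_span by (rule span_mono) simp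
    thus "orbit v \<in> {orbit v |v. v \<noteq> 0} \<and> P \<subseteq> orbit v" using v by blast
  next
    fix M assume "M \<in> {orbit v |v. v \<noteq> 0} \<and> P \<subseteq> M"
    then obtain w where "M = orbit w" "v \<in> orbit w" using v(1) by blast
    thus "M = orbit v" using orbit_eq v(2) by simp
  qed
qed

text \<open>
  The determinant of \<open>x, y, z\<close> over \<open>L\<close> vanishes for all \<open>z\<close> iff all \<open>2 \<times> 2\<close> minors of \<open>x, y\<close> do, that is,
  iff \<open>x\<close> and \<open>y\<close> are \<open>L\<close>-dependent; two independent vectors over \<open>K\<close> then span an \<open>L\<close>-line.
\<close>

lemma upper_radical_orbits:
  assumes alt: "alternating3_on UNIV \<chi>"
    and \<chi>: "\<And>x y. (\<forall>z. \<chi> x y z = 0) \<longleftrightarrow> (\<forall>z. wedge \<Phi> 1 2 3 x y z = 0)"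
  shows "upper_radical \<chi> = {orbit v |v. v \<noteq> 0}"
proof -
  have minors: "(\<forall>z. \<chi> x y z = 0) \<longleftrightarrow>
      (\<forall>i\<in>{1, 2, 3}. \<forall>j\<in>{1, 2, 3}. \<Phi> i x * \<Phi> j y = \<Phi> j x * \<Phi> i y)" for x y
  proof
    assume "\<forall>z. \<chi> x y z = 0"
    hence 0: "wedge \<Phi> 1 2 3 x y z = 0" for z using \<chi> by blast
    show "\<forall>i\<in>{1, 2, 3}. \<forall>j\<in>{1, 2, 3}. \<Phi> i x * \<Phi> j y = \<Phi> j x * \<Phi> i y"
      using 0[of "e 1"] 0[of "e 2"] 0[of "e 3"] by (simp add: wedge_def \<Phi>_e mult.commute)
  next
    assume h: "\<forall>i\<in>{1, 2, 3}. \<forall>j\<in>{1, 2, 3}. \<Phi> i x * \<Phi> j y = \<Phi> j x * \<Phi> i y"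
    have "wedge \<Phi> 1 2 3 x y z = \<Phi> 1 z * (\<Phi> 2 x * \<Phi> 3 y - \<Phi> 3 x * \<Phi> 2 y)
        + \<Phi> 2 z * (\<Phi> 3 x * \<Phi> 1 y - \<Phi> 1 x * \<Phi> 3 y)
        + \<Phi> 3 z * (\<Phi> 1 x * \<Phi> 2 y - \<Phi> 2 x * \<Phi> 1 y)" for z
      by (simp add: wedge_def algebra_simps)
    hence "wedge \<Phi> 1 2 3 x y z = 0" for z using h by auto
    thus "\<forall>z. \<chi> x y z = 0" using \<chi> by blast
  qed
  show ?thesis
  proof (intro Set.set_eqI iffI)
    fix M assume "M \<in> upper_radical \<chi>"
    hence M: "M \<in> lines" and 0: "\<And>u v z. u \<in> M \<Longrightarrow> v \<in> M \<Longrightarrow> \<chi> u v z = 0"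
      using upper_radical_iff[OF alt] by auto
    obtain x y where xy: "x \<in> M" "y \<in> M" "M = span {x, y}" "dim (span {x, y}) = 2"
      using line_basis[OF M] by metis
    have "x \<noteq> 0" using xy(4)[unfolded dim_span2_iff, rule_format, of 1 0] by auto
    then obtain k where k: "k \<in> {1, 2, 3}" "\<Phi> k x \<noteq> 0" by (auto simp: eq_iff_\<Phi>[of x])
    define a where "a = \<Phi> k y * inverse (\<Phi> k x)"
    have a: "a \<in> L" by (simp add: a_def)
    have "\<Phi> i y = a * \<Phi> i x" if "i \<in> {1, 2, 3}" for i
    proof -
      have "\<Phi> k x * \<Phi> i y = \<Phi> i x * \<Phi> k y" using minors 0 xy k(1) that by blast
      thus ?thesis using k(2) by (simp add: a_def field_simps)
    qed
    hence "y = smul a x" by (simp add: eq_iff_\<Phi> \<Phi>_smul a)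
    hence "y \<in> orbit x" using a by (auto simp: orbit_def)
    hence "orbit x = M"
      using line_eq_span[of "orbit x" x y] orbit_in_lines[OF \<open>x \<noteq> 0\<close>] xy by simp
    thus "M \<in> {orbit v |v. v \<noteq> 0}" using \<open>x \<noteq> 0\<close> by blast
  next
    fix M assume "M \<in> {orbit v |v. v \<noteq> 0}"
    then obtain v where v: "M = orbit v" "v \<noteq> 0" by auto
    have "\<forall>i\<in>{1, 2, 3}. \<forall>j\<in>{1, 2, 3}. \<Phi> i x * \<Phi> j y = \<Phi> j x * \<Phi> i y"
      if xy: "x \<in> M" "y \<in> M" for x y
    proof -
      obtain a b where "a \<in> L" "b \<in> L" "x = smul a v" "y = smul b v"
        using xy unfolding v(1) orbit_def by blast
      thus ?thesis by (intro ballI) (simp only: \<Phi>_smul mult_ac)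
    qed
    hence "\<forall>x\<in>M. \<forall>y\<in>M. \<forall>z. \<chi> x y z = 0" using minors by blast
    thus "M \<in> upper_radical \<chi>"
      using orbit_in_lines[OF v(2)] v(1) by (simp add: upper_radical_iff[OF alt])
  qed
qed

text \<open>
  If one coordinate of the \<open>L\<close>-valued determinant vanishes for all \<open>z\<close>, so does the same coordinate of
  its \<open>\<mu>\<close>-fold, obtained from \<open>smul \<mu> z\<close>. As \<open>p \<noteq> 0\<close>, multiplication by \<open>\<mu>\<close> brings the other
  coordinate into sight, whence the determinant is zero.
\<close>

lemma normal_form_T10:
  assumes alt: "alternating3_on UNIV \<chi>" and c: "c \<noteq> 0"
    and \<chi>: "(\<forall>x y z. \<chi> x y z = c * re (wedge \<Phi> 1 2 3 x y z)) \<or>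
            (\<forall>x y z. \<chi> x y z = c * im (wedge \<Phi> 1 2 3 x y z))"
  shows "form_rank \<chi> = 6" "desarguesian_line_spread \<iota> L (upper_radical \<chi>)"
proof -
  have radical: "(\<forall>z. \<chi> x y z = 0) \<longleftrightarrow> (\<forall>z. wedge \<Phi> 1 2 3 x y z = 0)" for x y
  proof
    assume 0: "\<forall>z. \<chi> x y z = 0"
    show "\<forall>z. wedge \<Phi> 1 2 3 x y z = 0"
    proof
      fix z
      obtain a b where ab: "wedge \<Phi> 1 2 3 x y z = \<iota> a + \<iota> b * \<mu>"
        by (metis wedge_\<Phi>)
      have "wedge \<Phi> 1 2 3 x y (smul \<mu> z) = \<mu> * wedge \<Phi> 1 2 3 x y z"
        by (simp add: wedge_def \<Phi>_smul algebra_simps)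
      hence "wedge \<Phi> 1 2 3 x y (smul \<mu> z) = \<iota> (b * p) + \<iota> (a + b * q) * \<mu>"
        by (simp only: ab \<mu>_times)
      with ab 0 \<chi> c have "a = 0 \<and> b * p = 0 \<or> b = 0 \<and> a + b * q = 0"
        by (metis im_coordinates mult_eq_0_iff re_coordinates)
      thus "wedge \<Phi> 1 2 3 x y z = 0" using p_nonzero by (auto simp: ab)
    qed
  next
    assume "\<forall>z. wedge \<Phi> 1 2 3 x y z = 0"
    thus "\<forall>z. \<chi> x y z = 0" using \<chi> re_coordinates[of 0 0] im_coordinates[of 0 0] by auto
  qed
  show "form_rank \<chi> = 6"
  proof (rule form_rank6)
    fix v assume v: "v \<in> Rad \<chi>"
    have "wedge \<Phi> 1 2 3 v y z = 0" for y z
      using radical[of v y] Rad_vanish[OF alt v] by blast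
    from this[of "e 2" "e 3"] this[of "e 3" "e 1"] this[of "e 1" "e 2"]
    show "v = 0" by (simp add: eq_iff_\<Phi>[of v] wedge_def \<Phi>_e)
  qed
  have "upper_radical \<chi> = {orbit v |v. v \<noteq> 0}"
    by (rule upper_radical_orbits[OF alt radical])
  thus "desarguesian_line_spread \<iota> L (upper_radical \<chi>)"
    using line_spread_orbits quadratic_extension_adjoin extends_scalars_smul three_dimensional_smul
    unfolding desarguesian_line_spread_def orbit_def by auto
qed

end

section \<open>From types to normal forms\<close>

context fd_vspace
begin

lemma type_T1_properties:
  assumes alt: "alternating3_on UNIV \<chi>" and "type_T1 \<chi>"
  shows "form_rank \<chi> = 3 \<and>
    trivial_hyperplane_centered_at (Rad \<chi>) (hyperplane3 UNIV \<chi>) \<and>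
    upper_radical \<chi> = {L \<in> lines. L \<inter> Rad \<chi> \<noteq> {0}}"
proof -
  obtain e f c where "3 \<le> dim UNIV" "dual_bases scale Basis (dim UNIV) e f" and c: "c \<noteq> 0"
    and \<chi>: "\<And>x y z. \<chi> x y z = c * wedge f 1 2 3 x y z"
    using assms(2) unfolding type_T1_def by (rule has_type_normal_form) simp
  then interpret dual_bases scale Basis "dim UNIV" e f by simp
  show ?thesis using normal_form_T1[OF \<open>3 \<le> dim UNIV\<close> alt c \<chi>] by blast
qed

lemma type_T2_properties:
  assumes alt: "alternating3_on UNIV \<chi>" and "type_T2 \<chi>"
  shows "form_rank \<chi> = 5 \<and>
    (dim UNIV = 6 \<longrightarrow> dim (Rad \<chi>) = 1 \<and> lower_radical \<chi> = {Rad \<chi>}) \<and>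
    (\<exists>V0 W H0. direct_sum V0 (Rad \<chi>) \<and> dim V0 = 5 \<and> W \<subseteq> V0 \<and> symplectic_GQ_lines W H0 \<and>
       is_Ext V0 (Rad \<chi>) (Exp V0 W H0) (hyperplane3 UNIV \<chi>) \<and>
       upper_radical \<chi> = {L \<in> lines. L \<in> H0 \<or> (\<exists>P\<in>lower_radical \<chi>. P \<subseteq> L) \<or>
         proj V0 (Rad \<chi>) ` L \<in> H0})"
proof -
  obtain e f c where "5 \<le> dim UNIV" "dual_bases scale Basis (dim UNIV) e f" and c: "c \<noteq> 0"
    and \<chi>: "\<And>x y z. \<chi> x y z = c * (wedge f 1 2 3 x y z + wedge f 1 4 5 x y z)"
    using assms(2) unfolding type_T2_def by (rule has_type_normal_form) simp
  then interpret dual_bases scale Basis "dim UNIV" e f by simp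
  show ?thesis using normal_form_T2[OF \<open>5 \<le> dim UNIV\<close> alt c \<chi>] by blast
qed

lemma has_type6_normal_form:
  assumes "dim UNIV \<le> 6" "has_type 6 F \<chi>"
  obtains e f c e0 g where "dual_bases6 scale Basis e f" "c \<noteq> 0"
    "\<And>x y z. \<chi> x y z = c * F e0 (g x) (g y) (g z)"
    "\<And>i j k x y z. tri e0 i j k (g x) (g y) (g z) = wedge f i j k x y z"
proof -
  show thesis
  proof (rule has_type_normal_form[OF assms(2)])
    fix e f c e0 g
    assume "6 \<le> dim UNIV" and db: "dual_bases scale Basis (dim UNIV) e f"
      and nf: "c \<noteq> 0" "\<And>x y z. \<chi> x y z = c * F e0 (g x) (g y) (g z)"
        "\<And>i j k x y z. tri e0 i j k (g x) (g y) (g z) = wedge f i j k x y z"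
    with assms(1) have "dim UNIV = 6" by simp
    with db have "dual_bases6 scale Basis e f" by (simp add: dual_bases6_def)
    thus thesis using nf by (rule that)
  qed
qed

lemma type_T3_properties:
  assumes alt: "alternating3_on UNIV \<chi>" and "dim UNIV \<le> 6" "type_T3 \<chi>"
  shows "form_rank \<chi> = 6 \<and>
    (\<exists>V0 V1 H0 H1. direct_sum V0 V1 \<and> dim V0 = 3 \<and> dim V1 = 3 \<and>
       is_Dec V0 V1 H0 H1 (hyperplane3 UNIV \<chi>) \<and>
       upper_radical \<chi> = {span {x, y} |x y. x \<in> V0 - {0} \<and> y \<in> V1 - {0}})"
proof -
  obtain e f c where "dual_bases6 scale Basis e f" and c: "c \<noteq> 0"
    and \<chi>: "\<And>x y z. \<chi> x y z = c * (wedge f 1 2 3 x y z + wedge f 4 5 6 x y z)"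
    using assms(2,3) unfolding type_T3_def by (rule has_type6_normal_form) simp
  then interpret dual_bases6 scale Basis e f by simp
  show ?thesis using normal_form_T3[OF alt c \<chi>] by blast
qed

lemma type_T4_properties:
  assumes alt: "alternating3_on UNIV \<chi>" and "dim UNIV \<le> 6" "type_T4 \<chi>"
  shows "form_rank \<chi> = 6 \<and>
    (\<exists>V0 V1 \<omega>. direct_sum V0 V1 \<and> dim V0 = 3 \<and> dim V1 = 3 \<and>
       general_linear \<omega> \<and> \<omega> ` V0 = V1 \<and> \<omega> ` V1 = V0 \<and>
       upper_radical \<chi> =
         {span {a + b, \<omega> a} |a b. a \<in> V0 - {0} \<and> b \<in> V1} \<union> {L \<in> lines. L \<subseteq> V1})"
proof -
  obtain e f c where "dual_bases6 scale Basis e f" and c: "c \<noteq> 0"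
    and \<chi>: "\<And>x y z. \<chi> x y z =
      c * (wedge f 1 6 2 x y z + wedge f 2 4 3 x y z + wedge f 1 3 5 x y z)"
    using assms(2,3) unfolding type_T4_def by (rule has_type6_normal_form) simp
  then interpret dual_bases6 scale Basis e f by simp
  show ?thesis using normal_form_T4[OF alt c \<chi>] by blast
qed

text \<open>
  Here \<open>\<mu>\<^sup>2 = l\<close>, and the normal form is the coordinate at \<open>1\<close> of the determinant. The rank claim
  concerns \<open>\<chi>\<close> alone, but is proved in the structure given by a root \<open>\<mu>\<close>, so a root has to be
  supplied.
\<close>

lemma type_T10_1_properties:
  assumes alt: "alternating3_on UNIV \<chi>" and dim: "dim UNIV \<le> 6" and T: "type_T10_1 l \<chi>"
  shows "form_rank \<chi> = 6 \<and>
    (\<forall>\<mu> :: 'a alg_closure. poly (map_poly to_ac (p10_1 l)) \<mu> = 0 \<longrightarrow>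
       desarguesian_line_spread to_ac (adjoin to_ac \<mu>) (upper_radical \<chi>))"
proof -
  obtain e f c where "dual_bases6 scale Basis e f" and c: "c \<noteq> 0"
    and \<chi>: "\<And>x y z. \<chi> x y z = c * (wedge f 1 2 3 x y z
        + l * (wedge f 1 5 6 x y z + wedge f 3 4 5 x y z + wedge f 4 2 6 x y z))"
    using T unfolding type_T10_1_def by (elim conjE has_type6_normal_form[OF dim]) simp
  then interpret dual_bases6 scale Basis e f by simp
  have "form_rank \<chi> = 6 \<and> desarguesian_line_spread to_ac (adjoin to_ac \<mu>) (upper_radical \<chi>)"
    if root: "poly (map_poly to_ac (p10_1 l)) \<mu> = 0" for \<mu> :: "'a alg_closure"
  proof -
    interpret quadratic_root to_ac \<mu> l 0
      using T root by (intro quadratic_root_to_ac) (simp_all add: type_T10_1_def p10_1_def)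
    interpret complex_structure scale Basis e f to_ac \<mu> l 0 ..
    have "\<chi> x y z = c * re (wedge \<Phi> 1 2 3 x y z)" for x y z
      unfolding wedge_\<Phi> re_coordinates by (simp add: \<chi>)
    thus ?thesis using normal_form_T10[OF alt c] by blast
  qed
  moreover have "\<exists>\<mu>. poly (map_poly to_ac (p10_1 l)) \<mu> = 0"
    by (rule quadratic_has_root_in_alg_closure) (simp add: p10_1_def)
  ultimately show ?thesis by blast
qed

text \<open>
  In characteristic 2 signs are irrelevant, so a root of \<open>t\<^sup>2 + l t + 1\<close> satisfies \<open>\<mu>\<^sup>2 = 1 + l \<mu>\<close>; the normal
  form is the coordinate at \<open>\<mu>\<close> of the determinant, with \<open>q\<^sup>2 + p = l\<^sup>2 + 1\<close> as coefficient of the last term.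
\<close>

lemma type_T10_2_properties:
  assumes alt: "alternating3_on UNIV \<chi>" and dim: "dim UNIV \<le> 6" and T: "type_T10_2 l \<chi>"
  shows "form_rank \<chi> = 6 \<and>
    (\<forall>\<mu> :: 'a alg_closure. poly (map_poly to_ac (p10_2 l)) \<mu> = 0 \<longrightarrow>
       desarguesian_line_spread to_ac (adjoin to_ac \<mu>) (upper_radical \<chi>))"
proof -
  obtain e f c where "dual_bases6 scale Basis e f" and c: "c \<noteq> 0"
    and \<chi>: "\<And>x y z. \<chi> x y z = c * (wedge f 1 2 6 x y z + wedge f 1 5 3 x y z + wedge f 2 3 4 x y z
        + (l\<^sup>2 + 1) * wedge f 4 5 6 x y z
        + l * (wedge f 1 5 6 x y z + wedge f 3 4 5 x y z + wedge f 4 2 6 x y z))"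
    using T unfolding type_T10_2_def by (elim conjE has_type6_normal_form[OF dim]) simp
  then interpret dual_bases6 scale Basis e f by simp
  have neg: "- a = a" for a :: 'a using T by (simp add: type_T10_2_def uminus_CHAR_2)
  have "form_rank \<chi> = 6 \<and> desarguesian_line_spread to_ac (adjoin to_ac \<mu>) (upper_radical \<chi>)"
    if root: "poly (map_poly to_ac (p10_2 l)) \<mu> = 0" for \<mu> :: "'a alg_closure"
  proof -
    interpret quadratic_root to_ac \<mu> 1 l
      using T root by (intro quadratic_root_to_ac) (simp_all add: type_T10_2_def p10_2_def neg)
    interpret complex_structure scale Basis e f to_ac \<mu> 1 l ..
    have "\<chi> x y z = c * im (wedge \<Phi> 1 2 3 x y z)" for x y z
      unfolding wedge_\<Phi> im_coordinates by (simp add: \<chi> algebra_simps)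
    thus ?thesis using normal_form_T10[OF alt c] by blast
  qed
  moreover have "\<exists>\<mu>. poly (map_poly to_ac (p10_2 l)) \<mu> = 0"
    by (rule quadratic_has_root_in_alg_closure) (simp add: p10_2_def)
  ultimately show ?thesis by blast
qed

end

theorem theorem1:
  fixes scale :: "'k::field \<Rightarrow> 'v::ab_group_add \<Rightarrow> 'v"
    and Basis :: "'v set"
    and \<chi> :: "'v \<Rightarrow> 'v \<Rightarrow> 'v \<Rightarrow> 'k"
    and H :: "'v set set"
  assumes V: "finite_dimensional_vector_space scale Basis"
    and dim_le: "vector_space.dim scale (UNIV :: 'v set) \<le> 6"
    and alt: "vspace.alternating3_on scale UNIV \<chi>"
    and nontrivial: "vspace.nonzero3_on UNIV \<chi>"
    and types: "vspace.type_T1 scale \<chi> \<or> vspace.type_T2 scale \<chi> \<or>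
      vspace.type_T3 scale \<chi> \<or> vspace.type_T4 scale \<chi> \<or>
      (\<exists>l. vspace.type_T10_1 scale l \<chi>) \<or> (\<exists>l. vspace.type_T10_2 scale l \<chi>)"
    and H: "H = vspace.hyperplane3 scale UNIV \<chi>"
  shows
    "(vspace.type_T1 scale \<chi> \<longrightarrow>
        vspace.form_rank scale \<chi> = 3 \<and>
        vspace.trivial_hyperplane_centered_at scale (vspace.Rad \<chi>) H \<and>
        vspace.upper_radical scale \<chi> =
          {L \<in> vspace.lines scale. L \<inter> vspace.Rad \<chi> \<noteq> {0}})
   \<and> (vspace.type_T2 scale \<chi> \<longrightarrow>
        vspace.form_rank scale \<chi> = 5 \<and>
        (vector_space.dim scale (UNIV :: 'v set) = 6 \<longrightarrow>
           vector_space.dim scale (vspace.Rad \<chi>) = 1 \<and>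
           vspace.lower_radical scale \<chi> = {vspace.Rad \<chi>}) \<and>
        (\<exists>V0 W H0.
           vspace.direct_sum scale V0 (vspace.Rad \<chi>) \<and>
           vector_space.dim scale V0 = 5 \<and> W \<subseteq> V0 \<and>
           vspace.symplectic_GQ_lines scale W H0 \<and>
           vspace.is_Ext scale V0 (vspace.Rad \<chi>) (vspace.Exp scale V0 W H0) H \<and>
           vspace.upper_radical scale \<chi> =
             {L \<in> vspace.lines scale.
                L \<in> H0 \<or>
                (\<exists>P \<in> vspace.lower_radical scale \<chi>. P \<subseteq> L) \<or>
                vspace.proj V0 (vspace.Rad \<chi>) ` L \<in> H0}))
   \<and> (vspace.type_T3 scale \<chi> \<longrightarrow>
        vspace.form_rank scale \<chi> = 6 \<and>
        (\<exists>V0 V1 H0 H1.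
           vspace.direct_sum scale V0 V1 \<and>
           vector_space.dim scale V0 = 3 \<and> vector_space.dim scale V1 = 3 \<and>
           vspace.is_Dec scale V0 V1 H0 H1 H \<and>
           vspace.upper_radical scale \<chi> =
             {module.span scale {x, y} |x y. x \<in> V0 - {0} \<and> y \<in> V1 - {0}}))
   \<and> (vspace.type_T4 scale \<chi> \<longrightarrow>
        vspace.form_rank scale \<chi> = 6 \<and>
        (\<exists>V0 V1 \<omega>.
           vspace.direct_sum scale V0 V1 \<and>
           vector_space.dim scale V0 = 3 \<and> vector_space.dim scale V1 = 3 \<and>
           vspace.general_linear scale \<omega> \<and> \<omega> ` V0 = V1 \<and> \<omega> ` V1 = V0 \<and>
           vspace.upper_radical scale \<chi> =
             {module.span scale {a + b, \<omega> a} |a b. a \<in> V0 - {0} \<and> b \<in> V1}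
             \<union> {L \<in> vspace.lines scale. L \<subseteq> V1}))
   \<and> (\<forall>l. vspace.type_T10_1 scale l \<chi> \<longrightarrow>
        vspace.form_rank scale \<chi> = 6 \<and>
        (\<forall>\<mu> :: 'k alg_closure. poly (map_poly to_ac (p10_1 l)) \<mu> = 0 \<longrightarrow>
           vspace.desarguesian_line_spread scale to_ac (adjoin to_ac \<mu>)
             (vspace.upper_radical scale \<chi>)))
   \<and> (\<forall>l. vspace.type_T10_2 scale l \<chi> \<longrightarrow>
        vspace.form_rank scale \<chi> = 6 \<and>
        (\<forall>\<mu> :: 'k alg_closure. poly (map_poly to_ac (p10_2 l)) \<mu> = 0 \<longrightarrow>
           vspace.desarguesian_line_spread scale to_ac (adjoin to_ac \<mu>)
             (vspace.upper_radical scale \<chi>)))"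
proof -
  interpret V: finite_dimensional_vector_space scale Basis by (rule V)
  interpret fd_vspace scale Basis by unfold_locales
  show ?thesis
    unfolding H
    by (rule conjI[OF impI[OF type_T1_properties[OF alt]]
          conjI[OF impI[OF type_T2_properties[OF alt]]
          conjI[OF impI[OF type_T3_properties[OF alt dim_le]]
          conjI[OF impI[OF type_T4_properties[OF alt dim_le]]
          conjI[OF allI[OF impI[OF type_T10_1_properties[OF alt dim_le]]]
            allI[OF impI[OF type_T10_2_properties[OF alt dim_le]]]]]]]])
qed

end
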